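(* Let $\Omega=\Omega_1\times\dots\times\Omega_K$ with each $\Omega_k\subseteq\mathbb{R}^{n_k}$ a non-empty polyhedron, let $x^0\in\Omega$, and let $\{x^l\}$ be the sequence generated from $x^0$ by the trust region algorithm with alternating projections (TRAP) described in the context, with model Hessian $B(x)=\nabla^2L(x)$ and regularisation coefficients $\sigma^l\in(\underline\sigma,\bar\sigma)$, $\underline\sigma>0$. Write $p^l:=y^l-x^l$ for the direction yielded by the refinement step. Assume that (i) $L$ is bounded below on $\{x\in\Omega: L(x)\le L(x^0)\}$; (ii) $L$ is continuously differentiable in an open set containing $\Omega$ and its gradient $\nabla L$ is uniformly continuous; (iii) there exists $\hat B>0$ such that $\|B(x)\|_2\le\hat B$ for all $x\in\Omega$; (iv) $\{x^l\}$ has a non-degenerate limit point $x^{\ast}$ such that, for some $\kappa>0$, $\langle v,H(x^{\ast})v\rangle\ge\kappa\|v\|_2^2$ for all $v\in\mathcal{N}_\Omega(x^{\ast})^\perp:=\{v\in\mathbb{R}^n:\langle w,v\rangle=0\ \ \forall w\in\mathcal{N}_\Omega(x^{\ast})\}$, where $H=\nabla^2L$; (v) given $\gamma^{\ast}\in(0,\gamma_2)$ and a sequence $\xi^l\in(0,1)$, whenever $\|p^l\|_\infty\le\gamma^{\ast}\Delta^l$ and $\mathcal{A}_\Omega(x^l)=\mathcal{A}_\Omega(x^l+p^l)$, the direction $p^l$ satisfies $$\big\|Z^l(Z^l)^\top\big(g_{\sigma^l}(x^l)+H_{\sigma^l}(x^l)p^l\big)\big\|_2\le\xi^l\,\big\|Z^l(Z^l)^\top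 g(x^l)\big\|_2 .$$ Let $\xi^{\ast}:=\limsup_{l\to+\infty}\xi^l$. Then, for a small enough $\bar\sigma$, the sequence $\{x^l\}$ converges Q-linearly to $x^{\ast}$ if $\xi^{\ast}<1$ is small enough. If $\xi^{\ast}=0$, the Q-linear convergence ratio can be made arbitrarily small by properly choosing $\bar\sigma$, resulting in almost Q-superlinear convergence.
   Context: Notation. $x=(x_1^\top,\dots,x_K^\top)^\top\in\mathbb{R}^n$ with $x_k\in\mathbb{R}^{n_k}$, $n=\sum_k n_k$. $\Omega_k=\{x_k\in\mathbb{R}^{n_k}:\langle\omega_{k,i},x_k\rangle\le h_{k,i},\ i=1,\dots,m_k\}$. $P_S$ is the Euclidean projection onto the closed convex set $S$. $\mathcal{A}_{\Omega_k}(x_k)$ is the set of indices $i$ with $\langle\omega_{k,i},x_k\rangle=h_{k,i}$, and $\mathcal{A}_\Omega(x)=\{(k,i): i\in\mathcal{A}_{\Omega_k}(x_k)\}$. $\mathcal{N}_\Omega(x)=\{v:\langle v,y-x\rangle\le0\ \forall y\in\Omega\}$ is the normal cone. $g(x)=\nabla L(x)$, $H(x)=\nabla^2L(x)$. A point $x\in\Omega$ is critical for $L+\iota_\Omega$ ($\iota_\Omega$ the indicator function of $\Omega$) iff $-g(x)\in\mathcal{N}_\Omega(x)$, and non-degenerate if $-g(x)\in\operatorname{ri}(\mathcal{N}_\Omega(x))$ (relative interior). A sequence $\{x^l\}$ converges to $x^{\ast}$ at a Q-linear rate $\varrho\in(0,1)$ if, for $l$ large enough, $\|x^{l+1}-x^{\ast}\|_2/\|x^l-x^{\ast}\|_2\le\varrho$;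 the convergence is Q-superlinear if this ratio tends to zero as $l\to\infty$. Model. At an iterate $x\in\Omega$, with $B(x)=\nabla^2L(x)$, $$m(x'):=L(x)+\langle g(x),x'-x\rangle+\tfrac12\langle x'-x,B(x)(x'-x)\rangle .$$ TRAP. Fixed parameters: initial radius $\Delta^0>0$; $0<\sigma_1<\sigma_2<1<\sigma_3$; $0<\eta_1<\eta_2<1$; $\gamma_1\in(0,1)$, $\gamma_2>0$; $\nu_0\in(0,1)$, $0<\nu_1<\nu_2$, $\nu_3,\nu_4,\nu_5>0$; $0<\underline\sigma<\bar\sigma$. One iteration from $x=x^l\in\Omega$ with radius $\Delta=\Delta^l>0$: (1) Cauchy point. For $k=1,\dots,K$ in order, let $m_k(u):=m(z_1,\dots,z_{k-1},u,x_{k+1},\dots,x_K)$ for $u\in\mathbb{R}^{n_k}$, $z_k(\alpha):=P_{\Omega_k}(x_k-\alpha\nabla m_k(x_k))$, and $z_k:=z_k(\alpha_k)$, where $\alpha_k>0$ satisfies: (a) $m_k(z_k)\le m_k(x_k)+\nu_0\langle\nabla m_k(x_k),z_k-x_k\rangle$ and $\|z_k-x_k\|_\infty\le\nu_2\Delta$; (b) $\alpha_k\in[\nu_4,\nu_5]$, or $\alpha_k\in[\nu_3\bar\alpha_k,\nu_5]$ for some $\bar\alpha_k>0$ such that $m_k(z_k(\bar\alpha_k))>m_k(x_k)+\nu_0\langle\nabla m_k(x_k),z_k(\bar\alpha_k)-x_k\rangle$ or $\|z_k(\bar\alpha_k)-x_k\|_\infty\ge\nu_1\Delta$. The Cauchy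 point is $z=z^l:=(z_1^\top,\dots,z_K^\top)^\top$. (2) Refinement. Find $y=y^l\in\Omega$ with $m(x)-m(y)\ge\gamma_1(m(x)-m(z))$, $\|y-x\|_\infty\le\gamma_2\Delta$, $\mathcal{A}_{\Omega_k}(z_k)\subseteq\mathcal{A}_{\Omega_k}(y_k)$ for all $k$. It is obtained by a monotone (safeguarded conjugate gradient) method started at $z$ on the regularised objective $m(y)+\frac{\sigma^l}{2}\|y-z\|_2^2$ with $\sigma^l\in(\underline\sigma,\bar\sigma)$, so that $m(y)+\frac{\sigma^l}{2}\|y-z\|_2^2\le m(z)$. (3) Update. $\rho^l:=\frac{L(x)-L(y)}{m(x)-m(y)}$. If $\rho^l<\eta_1$: $x^{l+1}=x^l$, $\Delta^{l+1}\in[\sigma_1\Delta^l,\sigma_2\Delta^l]$. If $\rho^l\in[\eta_1,\eta_2]$: $x^{l+1}=y^l$, $\Delta^{l+1}\in[\sigma_1\Delta^l,\sigma_3\Delta^l]$. If $\rho^l>\eta_2$: $x^{l+1}=y^l$, $\Delta^{l+1}\in[\Delta^l,\sigma_3\Delta^l]$. The stopping tolerance is taken to be $0$ and no iterate is critical, so that infinite sequences are generated. Regularised quantities at iteration $l$: $g_{\sigma^l}(x^l):=g(x^l)-\sigma^l(z^l-x^l)$ and $H_{\sigma^l}(x^l):=H(x^l)+\frac{\sigma^l}{2}I$. $Z^l$ is a matrix whose columns form an orthonormal basis of $V(z^l):=\{x\in\mathbb{R}^n:\langle\omega_{k,i},x_k\rangle=0,\ i\in\mathcal{A}_{\Omega_k}(z^l_k),\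 k=1,\dots,K\}$.
   Formalization: The formal theorem additionally assumes that the gradient of L is differentiable on Ω and that the Hessian ∇²L is continuous at x* relative to Ω (as when L is C²); without this continuity the claim that the ratio can be made arbitrarily small fails. *)

theory Defs
  imports "HOL-Analysis.Analysis"
begin

subsection \<open>Differential notions\<close>

definition grad :: "(real^'n \<Rightarrow> real) \<Rightarrow> real^'n \<Rightarrow> real^'n" where
  "grad f x = (THE d. GDERIV f x :> d)"

lemma grad_eqI:
  assumes "GDERIV f x :> d"
  shows "grad f x = d"
  unfolding grad_def
proof (rule the_equality)
  fix e assume "GDERIV f x :> e"
  with assms have "(\<lambda>h. h \<bullet> e) = (\<lambda>h. h \<bullet> d)"
    unfolding gderiv_def by (rule has_derivative_unique[rotated])
  then show "e = d" by (metis inner_commute vector_eq_ldot)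
qed (fact assms)

definition hess :: "(real^'n \<Rightarrow> real) \<Rightarrow> real^'n \<Rightarrow> real^'n^'n" where
  "hess f x = jacobian (grad f) (at x)"

subsection \<open>Products of polyhedra\<close>

text \<open>
  The space \<open>\<real>\<^sup>n = \<real>\<^sup>n\<^sub>1 \<times> \<dots> \<times> \<real>\<^sup>n\<^sub>K\<close> is \<open>real^'n\<close> with every coordinate assigned to one of the blocks
  \<open>1, \<dots>, K\<close>.  The factor \<open>\<real>\<^sup>n\<^sub>k\<close> is identified, isometrically for the Euclidean and the maximum norm,
  with the vectors of \<open>real^'n\<close> that vanish off block \<open>k\<close>.
\<close>

record ('n::finite) block_polyhedra =
  nblocks :: nat                        \<comment> \<open>\<open>K\<close>\<close>
  block_of :: "'n \<Rightarrow> nat"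
  ncons :: "nat \<Rightarrow> nat"                 \<comment> \<open>\<open>m\<^sub>k\<close>\<close>
  normal :: "nat \<Rightarrow> nat \<Rightarrow> real^'n"      \<comment> \<open>\<open>\<omega>\<^sub>k\<^sub>,\<^sub>i\<close>\<close>
  rhs :: "nat \<Rightarrow> nat \<Rightarrow> real"            \<comment> \<open>\<open>h\<^sub>k\<^sub>,\<^sub>i\<close>\<close>

definition block_space :: "('n::finite) block_polyhedra \<Rightarrow> nat \<Rightarrow> (real^'n) set" where
  "block_space P k = {u. \<forall>i. block_of P i \<noteq> k \<longrightarrow> u $ i = 0}"

definition block :: "('n::finite) block_polyhedra \<Rightarrow> nat \<Rightarrow> real^'n \<Rightarrow> real^'n" where
  "block P k x = (\<chi> i. if block_of P i = k then x $ i else 0)"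

definition Omega_block :: "('n::finite) block_polyhedra \<Rightarrow> nat \<Rightarrow> (real^'n) set" where
  "Omega_block P k = {u \<in> block_space P k. \<forall>i\<in>{1..ncons P k}. normal P k i \<bullet> u \<le> rhs P k i}"

definition Omega :: "('n::finite) block_polyhedra \<Rightarrow> (real^'n) set" where
  "Omega P = {x. \<forall>k\<in>{1..nblocks P}. block P k x \<in> Omega_block P k}"

definition is_block_polyhedra :: "('n::finite) block_polyhedra \<Rightarrow> bool" where
  "is_block_polyhedra P \<longleftrightarrow>
     range (block_of P) = {1..nblocks P} \<and>
     (\<forall>k\<in>{1..nblocks P}. \<forall>i\<in>{1..ncons P k}. normal P k i \<in> block_space P k) \<and>
     (\<forall>k\<in>{1..nblocks P}. Omega_block P k \<noteq> {})"

definition active_block :: "('n::finite) block_polyhedra \<Rightarrow> nat \<Rightarrow> real^'n \<Rightarrow> nat set" where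
  "active_block P k u = {i \<in> {1..ncons P k}. normal P k i \<bullet> u = rhs P k i}"

definition active :: "('n::finite) block_polyhedra \<Rightarrow> real^'n \<Rightarrow> (nat \<times> nat) set" where
  "active P x = {(k, i). k \<in> {1..nblocks P} \<and> i \<in> active_block P k (block P k x)}"

definition normal_cone :: "(real^'n) set \<Rightarrow> real^'n \<Rightarrow> (real^'n) set" where
  "normal_cone S x = {v. \<forall>y\<in>S. v \<bullet> (y - x) \<le> 0}"

definition critical :: "(real^'n \<Rightarrow> real) \<Rightarrow> (real^'n) set \<Rightarrow> real^'n \<Rightarrow> bool" where
  "critical L S x \<longleftrightarrow> x \<in> S \<and> - grad L x \<in> normal_cone S x"

definition nondegenerate :: "(real^'n \<Rightarrow> real) \<Rightarrow> (real^'n) set \<Rightarrow> real^'n \<Rightarrow> bool" where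
  "nondegenerate L S x \<longleftrightarrow> x \<in> S \<and> - grad L x \<in> rel_interior (normal_cone S x)"

subsection \<open>The algorithm\<close>

record trap_params =
  \<Delta>0 :: real
  \<sigma>1 :: real
  \<sigma>2 :: real
  \<sigma>3 :: real
  \<eta>1 :: real
  \<eta>2 :: real
  \<gamma>1 :: real
  \<gamma>2 :: real
  \<nu>0 :: real
  \<nu>1 :: real
  \<nu>2 :: real
  \<nu>3 :: real
  \<nu>4 :: real
  \<nu>5 :: real

definition is_trap_params :: "trap_params \<Rightarrow> bool" where
  "is_trap_params T \<longleftrightarrow>
     0 < \<Delta>0 T \<and>
     0 < \<sigma>1 T \<and> \<sigma>1 T < \<sigma>2 T \<and> \<sigma>2 T < 1 \<and> 1 < \<sigma>3 T \<and>
     0 < \<eta>1 T \<and> \<eta>1 T < \<eta>2 T \<and> \<eta>2 T < 1 \<and>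
     0 < \<gamma>1 T \<and> \<gamma>1 T < 1 \<and> 0 < \<gamma>2 T \<and>
     0 < \<nu>0 T \<and> \<nu>0 T < 1 \<and> 0 < \<nu>1 T \<and> \<nu>1 T < \<nu>2 T \<and>
     0 < \<nu>3 T \<and> 0 < \<nu>4 T \<and> 0 < \<nu>5 T"

definition model :: "(real^'n \<Rightarrow> real) \<Rightarrow> real^'n \<Rightarrow> real^'n \<Rightarrow> real" where
  "model L x x' = L x + grad L x \<bullet> (x' - x) + 1 / 2 * ((x' - x) \<bullet> (hess L x *v (x' - x)))"

text \<open>
  \<open>block_model P L x z k u\<close> is \<open>m(z\<^sub>1, \<dots>, z\<^sub>k\<^sub>-\<^sub>1, u\<^sub>k, x\<^sub>k\<^sub>+\<^sub>1, \<dots>, x\<^sub>K)\<close>.  It depends on \<open>u\<close> only through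
  block \<open>k\<close>, so its gradient in \<open>real^'n\<close> lies in \<open>block_space P k\<close> and is the gradient with
  respect to the block variable.
\<close>

definition block_model ::
  "('n::finite) block_polyhedra \<Rightarrow> (real^'n \<Rightarrow> real) \<Rightarrow> real^'n \<Rightarrow> real^'n \<Rightarrow> nat \<Rightarrow> real^'n \<Rightarrow> real" where
  "block_model P L x z k u =
     model L x (\<chi> i. if block_of P i < k then z $ i else if block_of P i = k then u $ i else x $ i)"

definition proj_arc ::
  "('n::finite) block_polyhedra \<Rightarrow> (real^'n \<Rightarrow> real) \<Rightarrow> real^'n \<Rightarrow> real^'n \<Rightarrow> nat \<Rightarrow> real \<Rightarrow> real^'n" where
  "proj_arc P L x z k \<alpha> =
     closest_point (Omega_block P k)
       (block P k x - \<alpha> *\<^sub>R grad (block_model P L x z k) (block P k x))"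

definition cauchy_point ::
  "('n::finite) block_polyhedra \<Rightarrow> trap_params \<Rightarrow> (real^'n \<Rightarrow> real) \<Rightarrow> real^'n \<Rightarrow> real \<Rightarrow> real^'n \<Rightarrow> bool" where
  "cauchy_point P T L x \<Delta> z \<longleftrightarrow>
     (\<forall>k\<in>{1..nblocks P}.
        let x\<^sub>k = block P k x; z\<^sub>k = block P k z;
            m\<^sub>k = block_model P L x z k; g\<^sub>k = grad m\<^sub>k x\<^sub>k; arc = proj_arc P L x z k
        in \<exists>\<alpha>>0. z\<^sub>k = arc \<alpha> \<and>
             m\<^sub>k z\<^sub>k \<le> m\<^sub>k x\<^sub>k + \<nu>0 T * (g\<^sub>k \<bullet> (z\<^sub>k - x\<^sub>k)) \<and>
             infnorm (z\<^sub>k - x\<^sub>k) \<le> \<nu>2 T * \<Delta> \<and>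
             (\<alpha> \<in> {\<nu>4 T..\<nu>5 T} \<or>
              (\<exists>\<alpha>'>0. \<alpha> \<in> {\<nu>3 T * \<alpha>'..\<nu>5 T} \<and>
                 (m\<^sub>k (arc \<alpha>') > m\<^sub>k x\<^sub>k + \<nu>0 T * (g\<^sub>k \<bullet> (arc \<alpha>' - x\<^sub>k)) \<or>
                  infnorm (arc \<alpha>' - x\<^sub>k) \<ge> \<nu>1 T * \<Delta>))))"

text \<open>
  Of the subspace solver that produces \<open>y\<close>, only the descent of the regularised objective enters.
\<close>

definition refinement ::
  "('n::finite) block_polyhedra \<Rightarrow> trap_params \<Rightarrow> (real^'n \<Rightarrow> real) \<Rightarrow> real^'n \<Rightarrow> real \<Rightarrow> real^'n \<Rightarrow>
   real \<Rightarrow> real^'n \<Rightarrow> bool" where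
  "refinement P T L x \<Delta> z \<sigma> y \<longleftrightarrow>
     y \<in> Omega P \<and>
     model L x x - model L x y \<ge> \<gamma>1 T * (model L x x - model L x z) \<and>
     infnorm (y - x) \<le> \<gamma>2 T * \<Delta> \<and>
     (\<forall>k\<in>{1..nblocks P}. active_block P k (block P k z) \<subseteq> active_block P k (block P k y)) \<and>
     model L x y + \<sigma> / 2 * (norm (y - z))\<^sup>2 \<le> model L x z"

definition trap_update ::
  "trap_params \<Rightarrow> (real^'n \<Rightarrow> real) \<Rightarrow> real^'n \<Rightarrow> real \<Rightarrow> real^'n \<Rightarrow> real^'n \<Rightarrow> real \<Rightarrow> bool" where
  "trap_update T L x \<Delta> y x' \<Delta>' \<longleftrightarrow>
     (let \<rho> = (L x - L y) / (model L x x - model L x y) in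
        (\<rho> < \<eta>1 T \<longrightarrow> x' = x \<and> \<Delta>' \<in> {\<sigma>1 T * \<Delta>..\<sigma>2 T * \<Delta>}) \<and>
        (\<rho> \<in> {\<eta>1 T..\<eta>2 T} \<longrightarrow> x' = y \<and> \<Delta>' \<in> {\<sigma>1 T * \<Delta>..\<sigma>3 T * \<Delta>}) \<and>
        (\<rho> > \<eta>2 T \<longrightarrow> x' = y \<and> \<Delta>' \<in> {\<Delta>..\<sigma>3 T * \<Delta>}))"

definition trap_run ::
  "('n::finite) block_polyhedra \<Rightarrow> trap_params \<Rightarrow> real \<Rightarrow> real \<Rightarrow> (real^'n \<Rightarrow> real) \<Rightarrow> real^'n \<Rightarrow>
   (nat \<Rightarrow> real^'n) \<Rightarrow> (nat \<Rightarrow> real) \<Rightarrow> (nat \<Rightarrow> real^'n) \<Rightarrow> (nat \<Rightarrow> real^'n) \<Rightarrow> (nat \<Rightarrow> real) \<Rightarrow> bool" where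
  "trap_run P T \<sigma>lo \<sigma>hi L x0 x \<Delta> z y \<sigma> \<longleftrightarrow>
     x 0 = x0 \<and> \<Delta> 0 = \<Delta>0 T \<and>
     (\<forall>l. \<sigma> l \<in> {\<sigma>lo<..<\<sigma>hi} \<and>
          cauchy_point P T L (x l) (\<Delta> l) (z l) \<and>
          refinement P T L (x l) (\<Delta> l) (z l) (\<sigma> l) (y l) \<and>
          trap_update T L (x l) (\<Delta> l) (y l) (x (Suc l)) (\<Delta> (Suc l)) \<and>
          \<not> critical L (Omega P) (x l))"

subsection \<open>Hypotheses on a run\<close>

definition limit_point :: "(nat \<Rightarrow> real^'n) \<Rightarrow> real^'n \<Rightarrow> bool" where
  "limit_point x a \<longleftrightarrow> (\<exists>r. strict_mono r \<and> (x \<circ> r) \<longlonglongrightarrow> a)"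

definition active_subspace :: "('n::finite) block_polyhedra \<Rightarrow> real^'n \<Rightarrow> (real^'n) set" where
  "active_subspace P z =
     {x. \<forall>k\<in>{1..nblocks P}. \<forall>i\<in>active_block P k (block P k z). normal P k i \<bullet> block P k x = 0}"

text \<open>
  A matrix \<open>Z\<close> with orthonormal columns is given by its set of columns, whose number varies along
  the run; \<open>ZZt Z v\<close> is the product \<open>Z Z\<^sup>T v\<close>.
\<close>

definition orthonormal_basis_of :: "(real^'n) set \<Rightarrow> (real^'n) set \<Rightarrow> bool" where
  "orthonormal_basis_of Z S \<longleftrightarrow> pairwise orthogonal Z \<and> (\<forall>b\<in>Z. norm b = 1) \<and> span Z = S"

definition ZZt :: "(real^'n) set \<Rightarrow> real^'n \<Rightarrow> real^'n" where
  "ZZt Z v = (\<Sum>b\<in>Z. (b \<bullet> v) *\<^sub>R b)"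

definition grad_reg :: "(real^'n \<Rightarrow> real) \<Rightarrow> real \<Rightarrow> real^'n \<Rightarrow> real^'n \<Rightarrow> real^'n" where
  "grad_reg L \<sigma> x z = grad L x - \<sigma> *\<^sub>R (z - x)"

definition hess_reg :: "(real^'n \<Rightarrow> real) \<Rightarrow> real \<Rightarrow> real^'n \<Rightarrow> real^'n^'n" where
  "hess_reg L \<sigma> x = hess L x + (\<sigma> / 2) *\<^sub>R mat 1"

definition inexact_refinement ::
  "('n::finite) block_polyhedra \<Rightarrow> (real^'n \<Rightarrow> real) \<Rightarrow> real \<Rightarrow> (nat \<Rightarrow> real) \<Rightarrow>
   (nat \<Rightarrow> real^'n) \<Rightarrow> (nat \<Rightarrow> real) \<Rightarrow> (nat \<Rightarrow> real^'n) \<Rightarrow> (nat \<Rightarrow> real^'n) \<Rightarrow> (nat \<Rightarrow> real) \<Rightarrow>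
   (nat \<Rightarrow> (real^'n) set) \<Rightarrow> bool" where
  "inexact_refinement P L \<gamma>s \<xi> x \<Delta> z y \<sigma> Z \<longleftrightarrow>
     (\<forall>l. let p = y l - x l in
        infnorm p \<le> \<gamma>s * \<Delta> l \<and> active P (x l) = active P (x l + p) \<longrightarrow>
        norm (ZZt (Z l) (grad_reg L (\<sigma> l) (x l) (z l) + hess_reg L (\<sigma> l) (x l) *v p))
          \<le> \<xi> l * norm (ZZt (Z l) (grad L (x l))))"

definition Q_linear :: "(nat \<Rightarrow> real^'n) \<Rightarrow> real^'n \<Rightarrow> real \<Rightarrow> bool" where
  "Q_linear x a \<rho> \<longleftrightarrow>
     0 < \<rho> \<and> \<rho> < 1 \<and> x \<longlonglongrightarrow> a \<and>
     (\<forall>\<^sub>F l in sequentially. norm (x (Suc l) - a) / norm (x l - a) \<le> \<rho>)"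

text \<open>
  Besides existence of the Hessian, the convention that \<open>L\<close> is twice continuously differentiable is
  used only through continuity of \<open>hess L\<close> at the limit point \<open>xs\<close>.
\<close>

definition local_convergence_setting ::
  "('n::finite) block_polyhedra \<Rightarrow> trap_params \<Rightarrow> real \<Rightarrow> real \<Rightarrow> (real^'n \<Rightarrow> real) \<Rightarrow> real^'n \<Rightarrow>
   real \<Rightarrow> real \<Rightarrow> (nat \<Rightarrow> real^'n) \<Rightarrow> real^'n \<Rightarrow> (nat \<Rightarrow> real) \<Rightarrow> bool" where
  "local_convergence_setting P T \<sigma>lo \<sigma>hi L x0 \<kappa> \<gamma>s x xs \<xi> \<longleftrightarrow>
     limit_point x xs \<and>
     nondegenerate L (Omega P) xs \<and>
     continuous (at xs within Omega P) (hess L) \<and>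
     (\<forall>v\<in>(normal_cone (Omega P) xs)\<^sup>\<bottom>. v \<bullet> (hess L xs *v v) \<ge> \<kappa> * (norm v)\<^sup>2) \<and>
     (\<forall>l. 0 < \<xi> l \<and> \<xi> l < 1) \<and>
     (\<exists>\<Delta> z y \<sigma> Z. trap_run P T \<sigma>lo \<sigma>hi L x0 x \<Delta> z y \<sigma> \<and>
        (\<forall>l. orthonormal_basis_of (Z l) (active_subspace P (z l))) \<and>
        inexact_refinement P L \<gamma>s \<xi> x \<Delta> z y \<sigma> Z)"

end

theory Submission
  imports Defs
begin

text \<open>
  Near the non-degenerate limit point the objective grows linearly across the active face and
  quadratically along it, so the limit point is a strict local minimiser.  The regularisation makes
  every accepted step decrease \<open>L\<close> by a multiple of its squared length; steps therefore tend to
  zero and the whole sequence converges.  The Cauchy point either lands on the active face or has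
  a length comparable to the trust region radius.  In both cases the step is bounded by the distance to
  the limit, the model becomes accurate to \<open>o(\<parallel>p\<parallel>\<^sup>2)\<close>, all steps become very successful, and the radius
  stays away from zero, which in turn forces identification of the active face.  From then on the
  method is an inexact regularised Newton method in a fixed subspace.
\<close>

subsection \<open>Projections and polyhedra\<close>

text \<open>The obstacle is a circle: face identification wants a radius bounded away from zero,
  this wants successful steps, these want trial steps that tend to zero, and objective decrease
  speaks of accepted steps only. The circle is broken by \<open>refinement_step_bound\<close>, which
  bounds every trial step near \<open>xs\<close>, rejected or not, by a multiple of the distance to
  \<open>xs\<close>, with a constant independent of the radius: either the face is already found and
  coercivity controls the tangential correction, or the radius itself is of the order of that
  distance.

  A second constraint is the order of quantifiers: the thresholds for \<open>\<sigma>hi\<close> and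
  \<open>\<xi>\<close> are fixed before the run and its limit point. Hence the constants that enter
  the rate (\<open>Bhat\<close>, \<open>\<kappa>\<close> and the constant of
  \<open>cauchy_step_bound\<close>) are obtained without reference to \<open>xs\<close>. The lower
  bound \<open>\<sigma>lo\<close> and the growth constants at \<open>xs\<close> influence only when
  the asymptotic regime starts.\<close>

lemma norm_matrix_vector_mult_le:
  fixes A :: "real^'n^'m"
  shows "norm (A *v x) \<le> norm A * norm x"
proof -
  have "norm (A *v x) = L2_set (\<lambda>i. norm (A $ i \<bullet> x)) UNIV"
    by (simp add: norm_vec_def[of "A *v x"] matrix_vector_mul_component)
  also have "\<dots> \<le> L2_set (\<lambda>i. norm x * norm (A $ i)) UNIV"
    by (intro L2_set_mono) (simp_all add: Cauchy_Schwarz_ineq2 mult.commute[of "norm x"])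
  also have "\<dots> = norm A * norm x"
    by (simp add: L2_set_right_distrib[symmetric] norm_vec_def mult.commute)
  finally show ?thesis .
qed

lemma norm_matrix_vector_mult_onorm:
  fixes A :: "real^'n^'m"
  assumes "onorm (\<lambda>v. A *v v) \<le> B"
  shows "norm (A *v x) \<le> B * norm x"
  by (meson assms matrix_vector_mul_bounded_linear mult_right_mono norm_ge_zero onorm order_trans)

text \<open>Along a projected-gradient arc the displacement grows with the step size, while
  displacement per unit of step size shrinks. Adding the two variational inequalities with weights
  \<open>b\<close> and \<open>a\<close> cancels \<open>d\<close>; Cauchy-Schwarz then leaves a
  quadratic in the two norms that factors as in \<open>prod\<close>.\<close>

lemma closest_point_arc_mono:
  fixes x d :: "'a::euclidean_space"
  assumes "convex S" "closed S" "x \<in> S" "0 < a" "a \<le> b"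
  defines "u \<equiv> closest_point S (x - a *\<^sub>R d) - x" and "v \<equiv> closest_point S (x - b *\<^sub>R d) - x"
  shows "norm u \<le> norm v" and "a * norm v \<le> b * norm u"
proof -
  let ?p = "closest_point S (x - a *\<^sub>R d)" and ?q = "closest_point S (x - b *\<^sub>R d)"
  have mem: "?p \<in> S" "?q \<in> S"
    using assms by (auto intro!: closest_point_in_set)
  have 1: "(- u - a *\<^sub>R d) \<bullet> (v - u) \<le> 0"
    using closest_point_dot[OF assms(1,2) mem(2), of "x - a *\<^sub>R d"] by (simp add: u_def v_def algebra_simps)
  have 2: "(- v - b *\<^sub>R d) \<bullet> (u - v) \<le> 0"
    using closest_point_dot[OF assms(1,2) mem(1), of "x - b *\<^sub>R d"] by (simp add: u_def v_def algebra_simps)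
  have "b * ((- u - a *\<^sub>R d) \<bullet> (v - u)) + a * ((- v - b *\<^sub>R d) \<bullet> (u - v)) \<le> 0"
    using 1 2 assms by (smt (verit) mult_nonneg_nonpos)
  then have "a * (v \<bullet> v) + b * (u \<bullet> u) \<le> (a + b) * (u \<bullet> v)"
    by (simp add: algebra_simps inner_commute)
  also have "\<dots> \<le> (a + b) * (norm u * norm v)"
    using assms by (intro mult_left_mono norm_cauchy_schwarz) auto
  finally have prod: "(norm v - norm u) * (a * norm v - b * norm u) \<le> 0"
    by (simp add: dot_square_norm power2_eq_square algebra_simps)
  show le: "norm u \<le> norm v"
  proof (rule ccontr)
    assume c: "\<not> norm u \<le> norm v"
    then have "a * norm v < a * norm u" using assms by simp
    also have "\<dots> \<le> b * norm u" using assms by (intro mult_right_mono) auto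
    finally show False using prod c by (smt (verit) mult_neg_neg)
  qed
  show "a * norm v \<le> b * norm u"
  proof (cases "norm u = norm v")
    case True
    then show ?thesis using assms by (simp add: mult_right_mono)
  next
    case False
    with le prod show ?thesis by (smt (verit) mult_pos_pos)
  qed
qed

text \<open>\<open>ZZt Z\<close> is the orthogonal projection onto \<open>V\<close>; these are the
  properties of it that the rate estimate uses.\<close>

lemma orthonormal_ZZt:
  fixes V :: "(real^'n) set"
  assumes "orthonormal_basis_of Z V"
  shows "v \<in> V \<Longrightarrow> v \<bullet> ZZt Z a = v \<bullet> a"
    and "ZZt Z a \<in> V"
    and "norm (ZZt Z a) \<le> norm a"
proof -
  have Z: "pairwise orthogonal Z" "\<And>b. b \<in> Z \<Longrightarrow> norm b = 1" "span Z = V"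
    using assms by (auto simp: orthonormal_basis_of_def)
  \<comment> \<open>Finiteness must be derived: over an infinite set of columns the sum in
    \<open>ZZt\<close> would be 0 by default.\<close>
  have "0 \<notin> Z" using Z(2) by force
  then have fin: "finite Z"
    using pairwise_orthogonal_independent[OF Z(1)] independent_imp_finite by blast
  have on_basis: "b \<bullet> ZZt Z a = b \<bullet> a" if b: "b \<in> Z" for a b
  proof -
    have "b \<bullet> ZZt Z a = (\<Sum>c\<in>Z. (c \<bullet> a) * (b \<bullet> c))"
      by (simp add: ZZt_def inner_sum_right)
    also have "\<dots> = (\<Sum>c\<in>Z. if c = b then b \<bullet> a else 0)"
    proof (rule sum.cong)
      fix c assume "c \<in> Z"
      then show "(c \<bullet> a) * (b \<bullet> c) = (if c = b then b \<bullet> a else 0)"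
        using Z(1) b Z(2)[OF b] by (auto simp: pairwise_def orthogonal_def norm_eq_1)
    qed simp
    finally show ?thesis using fin b by simp
  qed
  show *: "v \<bullet> ZZt Z a = v \<bullet> a" if "v \<in> V" for v a
  proof -
    have "v \<in> span Z" using that Z by simp
    then show ?thesis
    proof (induction rule: span_induct_alt)
      case base
      then show ?case by simp
    next
      case (step c x y)
      then show ?case by (simp add: inner_add_left on_basis)
    qed
  qed
  show mem: "ZZt Z a \<in> V"
    unfolding ZZt_def Z(3)[symmetric] by (intro span_sum span_scale span_base)
  have "norm (ZZt Z a) * norm (ZZt Z a) = ZZt Z a \<bullet> a"
    using *[OF mem, of a] by (simp add: dot_square_norm power2_eq_square)
  also have "\<dots> \<le> norm (ZZt Z a) * norm a"
    by (rule norm_cauchy_schwarz)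
  finally show "norm (ZZt Z a) \<le> norm a"
    by (cases "ZZt Z a = 0") auto
qed

section \<open>Normal cones and faces of a polyhedron\<close>

lemma normal_cone_convex: "convex (normal_cone S x)"
  unfolding normal_cone_def convex_def
  by (auto simp: inner_add_left intro: add_nonpos_nonpos mult_nonneg_nonpos)

text \<open>Strict complementarity in quantitative form.\<close>

lemma rel_interior_normal_cone_slack:
  assumes ri: "- g \<in> rel_interior (normal_cone S x)" and w: "w \<in> normal_cone S x"
  obtains t where "0 < t" "\<And>u. u \<in> S \<Longrightarrow> t * (w \<bullet> (x - u)) \<le> g \<bullet> (u - x)"
proof -
  have "normal_cone S x \<noteq> {}" using w by blast
  \<comment> \<open>Relative interiority lets the segment from \<open>w\<close> to
    \<open>- g\<close> be prolonged beyond \<open>- g\<close> inside the cone; the overshoot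
    \<open>e - 1\<close> becomes the slope \<open>t\<close>.\<close>
  then obtain e where e: "e > 1" "(1 - e) *\<^sub>R w + e *\<^sub>R (- g) \<in> normal_cone S x"
    using ri w convex_rel_interior_iff[OF normal_cone_convex] by blast
  show thesis
  proof
    show "0 < (e - 1) / e" using e by simp
    fix u assume "u \<in> S"
    then have "((1 - e) *\<^sub>R w + e *\<^sub>R (- g)) \<bullet> (u - x) \<le> 0"
      using e by (auto simp: normal_cone_def)
    then have "(e - 1) * (w \<bullet> (x - u)) \<le> e * (g \<bullet> (u - x))"
      by (simp add: algebra_simps)
    then show "(e - 1) / e * (w \<bullet> (x - u)) \<le> g \<bullet> (u - x)"
      using e by (simp add: divide_simps mult.commute)
  qed
qed

lemma inactive_constraints_stable:
  fixes \<omega> :: "'i \<Rightarrow> 'a::euclidean_space" and h :: "'i \<Rightarrow> real" and x :: 'a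
  assumes fin: "finite I"
  obtains \<delta> where "0 < \<delta>"
    "\<And>i v. i \<in> I \<Longrightarrow> \<omega> i \<bullet> x < h i \<Longrightarrow> norm v < \<delta> \<Longrightarrow> \<omega> i \<bullet> (x + v) < h i"
proof -
  define J where "J = {i\<in>I. \<omega> i \<bullet> x < h i}"
  have "finite J" using fin by (simp add: J_def)
  then have "open (\<Inter>i\<in>J. {u. \<omega> i \<bullet> u < h i})"
    by (intro open_INT ballI open_halfspace_lt)
  moreover have "x \<in> (\<Inter>i\<in>J. {u. \<omega> i \<bullet> u < h i})" by (simp add: J_def)
  ultimately obtain \<delta> where \<delta>: "\<delta> > 0" "ball x \<delta> \<subseteq> (\<Inter>i\<in>J. {u. \<omega> i \<bullet> u < h i})"
    using open_contains_ball by blast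
  show thesis
  proof
    show "0 < \<delta>" by fact
    fix i and v :: 'a assume "i \<in> I" "\<omega> i \<bullet> x < h i" and v: "norm v < \<delta>"
    then have "i \<in> J" by (simp add: J_def)
    moreover have "x + v \<in> ball x \<delta>" using v by (simp add: dist_norm)
    ultimately show "\<omega> i \<bullet> (x + v) < h i" using \<delta>(2) by blast
  qed
qed

lemma tangent_directions_feasible:
  fixes \<omega> :: "'i \<Rightarrow> 'a::euclidean_space" and h :: "'i \<Rightarrow> real" and x :: 'a
  assumes fin: "finite I" and x: "x \<in> {x. \<forall>i\<in>I. \<omega> i \<bullet> x \<le> h i}"
  obtains \<delta> where "0 < \<delta>"
    "\<And>v. v \<in> {v. \<forall>i\<in>{i\<in>I. \<omega> i \<bullet> x = h i}. \<omega> i \<bullet> v = 0} \<Longrightarrow> norm v < \<delta> \<Longrightarrow> x + v \<in> {x. \<forall>i\<in>I. \<omega> i \<bullet> x \<le> h i}"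
proof -
  obtain \<delta> where \<delta>: "0 < \<delta>"
    "\<And>i v. i \<in> I \<Longrightarrow> \<omega> i \<bullet> x < h i \<Longrightarrow> norm v < \<delta> \<Longrightarrow> \<omega> i \<bullet> (x + v) < h i"
    by (rule inactive_constraints_stable[OF fin, of \<omega> x h]) (rule that; assumption)
  show thesis
  proof (rule that[OF \<delta>(1)], intro CollectI ballI)
    fix v i assume "v \<in> {v. \<forall>i\<in>{i\<in>I. \<omega> i \<bullet> x = h i}. \<omega> i \<bullet> v = 0}" "norm v < \<delta>" "i \<in> I"
    then show "\<omega> i \<bullet> (x + v) \<le> h i"
      using x \<delta>(2)[of i v] by (cases "\<omega> i \<bullet> x = h i") (auto simp: inner_add_right less_le)
  qed
qed

text \<open>
  The slacks of the active constraints bound the part of \<open>u - x\<close> transversal to the face, since the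
  active normals are injective on the complement of its tangent space.
\<close>

lemma nondegenerate_face_split:
  fixes \<omega> :: "'i \<Rightarrow> real^'n" and h :: "'i \<Rightarrow> real" and x g :: "real^'n" and I :: "'i set"
  defines "Q \<equiv> {x. \<forall>i\<in>I. \<omega> i \<bullet> x \<le> h i}"
  assumes fin: "finite I" and x: "x \<in> Q" and ri: "- g \<in> rel_interior (normal_cone Q x)"
  defines "A \<equiv> {i\<in>I. \<omega> i \<bullet> x = h i}"
  obtains c \<delta> where "0 < c" "0 < \<delta>"
    "\<And>u. u \<in> Q \<Longrightarrow> norm (u - x) < \<delta> \<Longrightarrow>
       \<exists>v\<in>{v. \<forall>i\<in>A. \<omega> i \<bullet> v = 0}.
         norm v \<le> norm (u - x) \<and> x + v \<in> Q \<and> c * norm (u - x - v) \<le> g \<bullet> (u - x)"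
proof -
  have finA: "finite A" using fin by (simp add: A_def)
  define V where "V = {v. \<forall>i\<in>A. \<omega> i \<bullet> v = 0}"
  have subV: "subspace V" by (auto simp: V_def subspace_def inner_add_right)
  have ncone: "\<omega> i \<in> normal_cone Q x" if "i \<in> A" for i
    using that by (auto simp: A_def Q_def normal_cone_def inner_diff_right)
  have "\<exists>t>0. \<forall>u\<in>Q. t * (\<omega> i \<bullet> (x - u)) \<le> g \<bullet> (u - x)" if "i \<in> A" for i
    using rel_interior_normal_cone_slack[OF ri ncone[OF that]] by metis
  then obtain t where t: "\<And>i. i \<in> A \<Longrightarrow> t i > 0"
      "\<And>i u. i \<in> A \<Longrightarrow> u \<in> Q \<Longrightarrow> t i * (\<omega> i \<bullet> (x - u)) \<le> g \<bullet> (u - x)"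
    by metis
  have gpos: "0 \<le> g \<bullet> (u - x)" if "u \<in> Q" for u
    using ri rel_interior_subset that by (fastforce simp: normal_cone_def)
  obtain \<delta> where \<delta>pos: "0 < \<delta>" and inQ: "\<And>v. v \<in> V \<Longrightarrow> norm v < \<delta> \<Longrightarrow> x + v \<in> Q"
    by (rule tangent_directions_feasible[OF fin x[unfolded Q_def], folded Q_def A_def, folded V_def]) (rule that; assumption)
  \<comment> \<open>The Gram operator of the active normals. Since \<open>f w \<bullet> w\<close> is
    the sum of the squares of \<open>\<omega> i \<bullet> w\<close>, its kernel is \<open>V\<close>,
    so it is injective, hence bounded below, on the complement \<open>W\<close>.\<close>
  define f where "f w = (\<Sum>i\<in>A. (\<omega> i \<bullet> w) *\<^sub>R \<omega> i)" for w
  define W where "W = {w. \<forall>v\<in>V. w \<bullet> v = 0}"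
  have subW: "subspace W" by (auto simp: W_def subspace_def inner_add_left)
  have linf: "bounded_linear f"
    unfolding f_def by (intro bounded_linear_intros)
  have "w = 0" if "w \<in> W" "f w = 0" for w
  proof -
    have "(\<Sum>i\<in>A. (\<omega> i \<bullet> w)\<^sup>2) = f w \<bullet> w"
      by (simp add: f_def inner_sum_left power2_eq_square)
    then have "\<forall>i\<in>A. \<omega> i \<bullet> w = 0"
      using that finA by (simp add: sum_nonneg_eq_0_iff)
    then have "w \<in> V" by (simp add: V_def)
    with that show ?thesis by (auto simp: W_def)
  qed
  then obtain e where e: "e > 0" "\<And>w. w \<in> W \<Longrightarrow> norm (f w) \<ge> e * norm w"
    using injective_imp_isometric[OF closed_subspace[OF subW] subW linf] by blast
  \<comment> \<open>The summand 1 keeps \<open>M\<close> positive when no constraint is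
    active.\<close>
  define M where "M = 1 + (\<Sum>i\<in>A. norm (\<omega> i) / t i)"
  have M: "M > 0" unfolding M_def using t(1) by (intro add_pos_nonneg sum_nonneg divide_nonneg_nonneg) (auto intro: less_imp_le)
  show thesis
  proof
    show "0 < e / M" using e M by simp
    show "0 < \<delta>" by fact
    fix u assume u: "u \<in> Q" "norm (u - x) < \<delta>"
    obtain v w where vw: "v \<in> span V" "\<And>v'. v' \<in> span V \<Longrightarrow> orthogonal w v'" "u - x = v + w"
      using orthogonal_subspace_decomp_exists[of V "u - x"] by metis
    have v: "v \<in> V" using vw subV by (simp add: span_eq_iff[THEN iffD2])
    have w: "w \<in> W" using vw subV by (auto simp: W_def orthogonal_def span_base)
    have "(norm (u - x))\<^sup>2 = (norm v)\<^sup>2 + (norm w)\<^sup>2"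
      using vw by (metis norm_add_Pythagorean orthogonal_commute)
    then have nv: "norm v \<le> norm (u - x)"
      by (metis le_add_same_cancel1 norm_ge_zero power2_le_imp_le zero_le_power2)
    have "norm (f w) \<le> (\<Sum>i\<in>A. g \<bullet> (u - x) * (norm (\<omega> i) / t i))"
      unfolding f_def
    proof (rule sum_norm_le)
      fix i assume i: "i \<in> A"
      \<comment> \<open>The tangential part \<open>v\<close> does not change an active constraint,
        so \<open>w\<close> carries the whole slack, which \<open>t i\<close> bounds by the growth
        of the linear term.\<close>
      have "\<omega> i \<bullet> w = - (\<omega> i \<bullet> (x - u))"
        using vw(3) v i by (simp add: V_def inner_diff_right algebra_simps flip: inner_add_right)
      moreover have "0 \<le> \<omega> i \<bullet> (x - u)" using i u by (simp add: A_def Q_def inner_diff_right)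
      ultimately have "\<bar>\<omega> i \<bullet> w\<bar> \<le> g \<bullet> (u - x) / t i"
        using t(1)[OF i] t(2)[OF i u(1)] by (simp add: pos_le_divide_eq mult.commute)
      then show "norm ((\<omega> i \<bullet> w) *\<^sub>R \<omega> i) \<le> g \<bullet> (u - x) * (norm (\<omega> i) / t i)"
        using mult_right_mono[OF _ norm_ge_zero, of "\<bar>\<omega> i \<bullet> w\<bar>" "g \<bullet> (u - x) / t i" "\<omega> i"] by simp
    qed
    also have "\<dots> = (g \<bullet> (u - x)) * (M - 1)"
      by (simp add: M_def sum_distrib_left)
    also have "\<dots> \<le> (g \<bullet> (u - x)) * M"
      using gpos[OF u(1)] by (intro mult_left_mono) auto
    finally have "e * norm w \<le> (g \<bullet> (u - x)) * M"
      using e(2)[OF w] by linarith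
    then have "e / M * norm (u - x - v) \<le> g \<bullet> (u - x)"
      using M vw(3) by (simp add: divide_simps mult.commute)
    then show "\<exists>v\<in>{v. \<forall>i\<in>A. \<omega> i \<bullet> v = 0}.
         norm v \<le> norm (u - x) \<and> x + v \<in> Q \<and> e / M * norm (u - x - v) \<le> g \<bullet> (u - x)"
      using v nv inQ[OF v] u by (intro bexI[of _ v]) (auto simp: V_def)
  qed
qed

subsection \<open>Block structure and the Cauchy point\<close>

lemma block_nth [simp]: "block P k x $ i = (if block_of P i = k then x $ i else 0)"
  by (simp add: block_def)

lemma block_add: "block P k (x + y) = block P k x + block P k y"
  and block_diff: "block P k (x - y) = block P k x - block P k y"
  and block_scaleR: "block P k (c *\<^sub>R x) = c *\<^sub>R block P k x"
  by (simp_all add: vec_eq_iff)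

lemma bounded_linear_block: "bounded_linear (block P k)"
  by (simp add: linear_conv_bounded_linear[symmetric] linear_iff block_add block_scaleR)

lemma inner_block: "block P k x \<bullet> y = x \<bullet> block P k y"
  by (auto simp: inner_vec_def intro!: sum.cong)

lemma norm_block_le: "norm (block P k x) \<le> norm x"
  by (rule norm_le_componentwise_cart) auto

lemma block_in_space [simp]: "block P k x \<in> block_space P k"
  by (simp add: block_space_def)

lemma block_of_space: "u \<in> block_space P k \<Longrightarrow> block P k u = u"
  by (auto simp: block_space_def vec_eq_iff)

lemma block_block [simp]: "block P k (block P k x) = block P k x"
  by (simp add: block_of_space)

lemma block_block_other: "j \<noteq> k \<Longrightarrow> block P j (block P k x) = 0"
  by (simp add: vec_eq_iff)

lemma subspace_block_space: "subspace (block_space P k)"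
  by (auto simp: subspace_def block_space_def)

text \<open>The displacement already made when the Gauss-Seidel sweep reaches block
  \<open>k\<close>: the block model is expanded at \<open>x + prefix P k (z - x)\<close>. It runs
  from 0 at \<open>k = 1\<close> to the full step, so model changes telescope over the
  blocks.\<close>

definition prefix :: "('n::finite) block_polyhedra \<Rightarrow> nat \<Rightarrow> real^'n \<Rightarrow> real^'n" where
  "prefix P k d = (\<chi> i. if block_of P i < k then d $ i else 0)"

lemma prefix_Suc: "prefix P (Suc k) d = prefix P k d + block P k d"
  by (auto simp: prefix_def vec_eq_iff less_Suc_eq)

lemma prefix_norm_le: "norm (prefix P k d) \<le> norm d"
  by (rule norm_le_componentwise_cart) (simp add: prefix_def)

text \<open>The gradient of the block model, the block components before \<open>k\<close> having moved by \<open>w\<close>.\<close>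

definition block_grad ::
  "('n::finite) block_polyhedra \<Rightarrow> (real^'n \<Rightarrow> real) \<Rightarrow> real^'n \<Rightarrow> real^'n \<Rightarrow> nat \<Rightarrow> real^'n" where
  "block_grad P L x w k = block P k (grad L x + (1 / 2) *\<^sub>R (hess L x *v w + w v* hess L x))"

lemma block_model_eq:
  "block_model P L x z k u = model L x (x + (prefix P k (z - x) + block P k (u - x)))"
  unfolding block_model_def by (rule arg_cong[where f = "model L x"]) (auto simp: vec_eq_iff prefix_def)

text \<open>The model is quadratic, so its expansion at \<open>x + w\<close> is exact. The
  derivative of \<open>w \<bullet> (hess L x *v w)\<close> involves the matrix and its transpose,
  whence the symmetrised product.\<close>

lemma model_add:
  "model L x (x + (w + s)) = model L x (x + w) +
     (grad L x + (1 / 2) *\<^sub>R (hess L x *v w + w v* hess L x)) \<bullet> s + 1 / 2 * (s \<bullet> (hess L x *v s))"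
  by (simp add: model_def inner_add_left inner_add_right dot_lmul_matrix matrix_vector_right_distrib
      inner_commute[of "hess L x *v w"] algebra_simps)

lemma block_model_expand:
  assumes "s \<in> block_space P k"
  shows "block_model P L x z k (block P k x + s) = block_model P L x z k (block P k x) +
     block_grad P L x (prefix P k (z - x)) k \<bullet> s + 1 / 2 * (s \<bullet> (hess L x *v s))"
proof -
  have "block P k (block P k x + s) - block P k x = s" "block P k (block P k x - x) = 0"
    using assms by (simp_all add: block_diff block_add block_of_space)
  then show ?thesis
    using assms by (simp add: block_model_eq block_diff model_add block_grad_def inner_block block_of_space)
qed

text \<open>\<open>grad\<close> is a definite description; the explicit derivative is what makes the
  projection arc computable.\<close>

lemma GDERIV_block_model:
  "GDERIV (block_model P L x z k) (block P k x) :> block_grad P L x (prefix P k (z - x)) k"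
proof -
  let ?H = "hess L x" and ?w = "prefix P k (z - x)" and ?u = "block P k x"
  define d where "d u = ?w + block P k (u - x)" for u
  have d: "(d has_derivative block P k) (at ?u)"
    unfolding d_def
    by (auto intro!: derivative_eq_intros bounded_linear.has_derivative[OF bounded_linear_block])
  have Hd: "((\<lambda>u. ?H *v d u) has_derivative (\<lambda>h. ?H *v block P k h)) (at ?u)"
    by (rule bounded_linear.has_derivative[OF matrix_vector_mul_bounded_linear d])
  have d0: "d ?u = ?w" by (simp add: d_def block_diff)
  have "((\<lambda>u. L x + grad L x \<bullet> d u + 1 / 2 * (d u \<bullet> (?H *v d u))) has_derivative
      (\<lambda>h. grad L x \<bullet> block P k h + 1 / 2 * (?w \<bullet> (?H *v block P k h) + block P k h \<bullet> (?H *v ?w)))) (at ?u)"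
    by (auto intro!: derivative_eq_intros d Hd simp: d0)
  moreover have "(\<lambda>h. grad L x \<bullet> block P k h + 1 / 2 * (?w \<bullet> (?H *v block P k h) + block P k h \<bullet> (?H *v ?w)))
      = (\<lambda>h. h \<bullet> block_grad P L x ?w k)"
  proof
    fix h
    have "block P k v \<bullet> h = block P k h \<bullet> v" for v
      by (metis inner_block inner_commute)
    then show "grad L x \<bullet> block P k h + 1 / 2 * (?w \<bullet> (?H *v block P k h) + block P k h \<bullet> (?H *v ?w))
        = h \<bullet> block_grad P L x ?w k"
      unfolding block_grad_def inner_block[symmetric] inner_add_right inner_scaleR_right
        dot_lmul_matrix[symmetric] inner_commute[of "grad L x"] inner_commute[of "?w v* ?H"]
      by (simp add: algebra_simps)
  qed
  ultimately show ?thesis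
    by (simp only: gderiv_def block_model_eq[abs_def] model_def d_def add_diff_cancel_left')
qed

lemmas grad_block_model = grad_eqI[OF GDERIV_block_model]

text \<open>The bound passes to the transpose: applying it to the vector
  \<open>w v* hess L x\<close> estimates the square of that vector's norm by
  \<open>B * norm w\<close> times its norm.\<close>

lemma norm_symmetrised_hess_le:
  fixes x :: "real^'n"
  assumes "onorm (\<lambda>v. hess L x *v v) \<le> B"
  shows "norm ((1 / 2) *\<^sub>R (hess L x *v w + w v* hess L x)) \<le> B * norm w"
proof -
  have B: "norm (hess L x *v v) \<le> B * norm v" for v
    by (rule norm_matrix_vector_mult_onorm[OF assms])
  have "norm (w v* hess L x) * norm (w v* hess L x) = w \<bullet> (hess L x *v (w v* hess L x))"
    by (simp add: dot_lmul_matrix[symmetric] dot_square_norm power2_eq_square)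
  also have "\<dots> \<le> norm w * (B * norm (w v* hess L x))"
    by (meson B mult_left_mono norm_cauchy_schwarz norm_ge_zero order_trans)
  finally have "norm (w v* hess L x) * norm (w v* hess L x) \<le> norm (w v* hess L x) * (B * norm w)"
    by (simp add: algebra_simps)
  then have "norm (w v* hess L x) \<le> B * norm w"
    using order_trans[OF norm_ge_zero B[of w]] by (cases "w v* hess L x = 0") auto
  then show ?thesis
    using B[of w] norm_triangle_ineq[of "hess L x *v w" "w v* hess L x"] by simp
qed

lemma norm_block_grad_diff_le:
  fixes x :: "real^'n"
  assumes "onorm (\<lambda>v. hess L x *v v) \<le> B"
  shows "norm (block_grad P L x w k - block P k g) \<le> norm (grad L x - g) + B * norm w"
proof -
  have "norm (block_grad P L x w k - block P k g)
      \<le> norm ((grad L x - g) + (1 / 2) *\<^sub>R (hess L x *v w + w v* hess L x))"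
    unfolding block_grad_def block_diff[symmetric]
    by (rule order_trans[OF norm_block_le]) (simp add: algebra_simps)
  also have "\<dots> \<le> norm (grad L x - g) + B * norm w"
    using norm_symmetrised_hess_le[OF assms, of w] by (smt (verit) norm_triangle_ineq)
  finally show ?thesis .
qed

section \<open>The product of the blocks as a single polyhedron\<close>

locale block_polyhedra =
  fixes P :: "('n::finite) block_polyhedra"
  assumes is_block_polyhedra: "is_block_polyhedra P"
begin

text \<open>One finite index set for all blocks puts \<open>Omega P\<close> into the form that the
  face lemmas above require.\<close>

definition constraints :: "(nat \<times> nat) set" where
  "constraints = (SIGMA k:{1..nblocks P}. {1..ncons P k})"

lemma finite_constraints: "finite constraints"
  by (simp add: constraints_def)

lemma block_of_mem: "block_of P i \<in> {1..nblocks P}"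
  using is_block_polyhedra by (auto simp: is_block_polyhedra_def)

lemma normal_inner_block: "(k, i) \<in> constraints \<Longrightarrow> normal P k i \<bullet> block P k x = normal P k i \<bullet> x"
  using is_block_polyhedra
  by (auto simp: is_block_polyhedra_def constraints_def inner_block[symmetric] block_of_space)

lemma Omega_eq: "Omega P = {x. \<forall>j\<in>constraints. normal P (fst j) (snd j) \<bullet> x \<le> rhs P (fst j) (snd j)}"
  using normal_inner_block by (fastforce simp: Omega_def Omega_block_def constraints_def)

lemma active_eq: "active P x = {j \<in> constraints. normal P (fst j) (snd j) \<bullet> x = rhs P (fst j) (snd j)}"
  using normal_inner_block by (force simp: active_def active_block_def constraints_def)

lemma active_subspace_eq: "active_subspace P z = {v. \<forall>j\<in>active P z. normal P (fst j) (snd j) \<bullet> v = 0}"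
  using normal_inner_block by (force simp: active_subspace_def active_def active_block_def constraints_def)

lemma convex_Omega: "convex (Omega P)"
proof -
  have "Omega P = (\<Inter>j\<in>constraints. {x. normal P (fst j) (snd j) \<bullet> x \<le> rhs P (fst j) (snd j)})"
    by (auto simp: Omega_eq)
  then show ?thesis by (auto intro!: convex_INT convex_halfspace_le)
qed

lemma Omega_block_eq:
  "Omega_block P k = block_space P k \<inter> (\<Inter>i\<in>{1..ncons P k}. {u. normal P k i \<bullet> u \<le> rhs P k i})"
  by (auto simp: Omega_block_def)

lemma convex_Omega_block: "convex (Omega_block P k)"
  unfolding Omega_block_eq
  by (intro convex_Int convex_INT convex_halfspace_le subspace_imp_convex subspace_block_space)

lemma closed_Omega_block: "closed (Omega_block P k)"
  unfolding Omega_block_eq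
  by (intro closed_Int closed_INT ballI closed_halfspace_le closed_subspace subspace_block_space)

lemma Omega_block_space: "u \<in> Omega_block P k \<Longrightarrow> block P k u = u"
  by (simp add: Omega_block_def block_of_space)

lemma block_Omega: "x \<in> Omega P \<Longrightarrow> k \<in> {1..nblocks P} \<Longrightarrow> block P k x \<in> Omega_block P k"
  by (simp add: Omega_def)

lemma replace_block_Omega:
  assumes "x \<in> Omega P" "u \<in> Omega_block P k"
  shows "x + (u - block P k x) \<in> Omega P"
  unfolding Omega_def
proof (intro CollectI ballI)
  fix j assume j: "j \<in> {1..nblocks P}"
  have "block P j (x + (u - block P k x)) = (if j = k then u else block P j x)"
    using Omega_block_space[OF assms(2)]
    by (auto simp: block_add block_diff) (metis block_block_other diff_zero diff_self)
  then show "block P j (x + (u - block P k x)) \<in> Omega_block P j"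
    using assms j by (auto simp: Omega_def)
qed

lemma sum_block: "(\<Sum>k\<in>{1..nblocks P}. block P k x) = x"
  using block_of_mem by (simp add: vec_eq_iff)

lemma sum_norm_block: "(\<Sum>k\<in>{1..nblocks P}. (norm (block P k x))\<^sup>2) = (norm x)\<^sup>2"
proof -
  have "(\<Sum>k\<in>{1..nblocks P}. (norm (block P k x))\<^sup>2) = (\<Sum>k\<in>{1..nblocks P}. x \<bullet> block P k x)"
    by (simp add: dot_square_norm[symmetric] inner_block)
  also have "\<dots> = (norm x)\<^sup>2"
    by (simp add: inner_sum_right[symmetric] sum_block dot_square_norm del: One_nat_def)
  finally show ?thesis .
qed

lemma prefix_first: "prefix P 1 d = 0"
proof -
  have "(if block_of P i < 1 then d $ i else 0) = 0" for i using block_of_mem[of i] by simp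
  then show ?thesis by (simp only: prefix_def vec_eq_iff vec_lambda_beta zero_index) simp
qed

lemma prefix_last: "prefix P (Suc (nblocks P)) d = d"
  using block_of_mem by (auto simp: prefix_def vec_eq_iff less_Suc_eq_le)

end

section \<open>Sufficient decrease and step sizes of the Cauchy point\<close>

locale trap =
  block_polyhedra P for P :: "('n::finite) block_polyhedra" +
  fixes T :: trap_params
    and L :: "real^'n \<Rightarrow> real"
    and Bhat :: real
  assumes is_trap_params: "is_trap_params T"
    and L_differentiable: "\<And>x. x \<in> Omega P \<Longrightarrow> L differentiable (at x)"
    and grad_differentiable: "\<And>x. x \<in> Omega P \<Longrightarrow> grad L differentiable (at x)"
    and Bhat_pos: "0 < Bhat"
    and hess_bound: "\<And>x. x \<in> Omega P \<Longrightarrow> onorm (\<lambda>v. hess L x *v v) \<le> Bhat"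
begin

lemma params:
  "0 < \<Delta>0 T" "0 < \<sigma>1 T" "0 < \<eta>1 T" "\<eta>1 T < \<eta>2 T" "\<eta>2 T < 1" "0 < \<gamma>2 T" "0 < \<nu>0 T" "\<nu>0 T < 1"
  "0 < \<nu>1 T" "0 < \<nu>3 T" "0 < \<nu>4 T" "0 < \<nu>5 T"
  using is_trap_params by (auto simp: is_trap_params_def)

lemma norm_hess_le: "x \<in> Omega P \<Longrightarrow> norm (hess L x *v v) \<le> Bhat * norm v"
  by (rule norm_matrix_vector_mult_onorm[OF hess_bound])

lemma inner_hess_le: "x \<in> Omega P \<Longrightarrow> \<bar>u \<bullet> (hess L x *v v)\<bar> \<le> Bhat * norm u * norm v"
  by (smt (verit) Cauchy_Schwarz_ineq2 mult.assoc mult.commute mult_left_mono norm_ge_zero norm_hess_le)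

text \<open>
  The lower bound on \<open>\<alpha>\<close> comes from the failure of sufficient decrease at the trial step \<open>\<alpha>'\<close>, the
  lower bound on the step from \<open>\<alpha>'\<close> reaching the boundary of the trust region.
\<close>

lemma cauchy_block:
  assumes cp: "cauchy_point P T L x \<Delta> z" and x: "x \<in> Omega P" and k: "k \<in> {1..nblocks P}"
  defines "s \<equiv> block P k (z - x)" and "w \<equiv> prefix P k (z - x)"
  obtains \<alpha> where "0 < \<alpha>" "\<alpha> \<le> \<nu>5 T" "block P k z \<in> Omega_block P k"
    "\<And>u. u \<in> Omega_block P k \<Longrightarrow> (s + \<alpha> *\<^sub>R block_grad P L x w k) \<bullet> (block P k z - u) \<le> 0"
    "\<nu>0 T * (norm s)\<^sup>2 \<le> \<alpha> * (model L x (x + w) - model L x (x + prefix P (Suc k) (z - x)))"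
    "min (\<nu>4 T) (\<nu>3 T * (2 * (1 - \<nu>0 T) / Bhat)) \<le> \<alpha> \<or> min 1 (\<nu>3 T) * \<nu>1 T * \<Delta> \<le> norm s"
proof -
  let ?m = "block_model P L x z k" and ?x = "block P k x" and ?z = "block P k z"
    and ?arc = "proj_arc P L x z k" and ?g = "block_grad P L x w k" and ?S = "Omega_block P k"
  note S = convex_Omega_block[of k] closed_Omega_block[of k]
  have xk: "?x \<in> ?S" using block_Omega[OF x k] .
  have arc: "?arc a = closest_point ?S (?x - a *\<^sub>R ?g)" for a
    by (simp add: proj_arc_def grad_block_model w_def)
  have arc_mem: "?arc a \<in> ?S" for a
    unfolding arc using S xk by (intro closest_point_in_set) auto
  have arc_dot: "(?x - a *\<^sub>R ?g - ?arc a) \<bullet> (u - ?arc a) \<le> 0" if "u \<in> ?S" for a u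
    unfolding arc by (rule closest_point_dot[OF S that])
  \<comment> \<open>The projection inequality tested at the current block, which is itself
    feasible.\<close>
  have arc_descent: "(norm (?arc a - ?x))\<^sup>2 \<le> a * - (?g \<bullet> (?arc a - ?x))" for a
    using arc_dot[OF xk, of a] by (simp add: dot_square_norm[symmetric] algebra_simps inner_commute)
  have m_arc: "?m (?arc a) = ?m ?x + ?g \<bullet> (?arc a - ?x) + 1 / 2 * ((?arc a - ?x) \<bullet> (hess L x *v (?arc a - ?x)))" for a
  proof -
    have "?arc a - ?x \<in> block_space P k"
      using arc_mem[of a] by (simp add: Omega_block_def subspace_diff[OF subspace_block_space])
    from block_model_expand[OF this, of L x z] show ?thesis by (simp add: w_def)
  qed
  obtain \<alpha> where \<alpha>: "\<alpha> > 0" "?z = ?arc \<alpha>" "?m ?z \<le> ?m ?x + \<nu>0 T * (?g \<bullet> (?z - ?x))"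
    "\<alpha> \<in> {\<nu>4 T..\<nu>5 T} \<or> (\<exists>\<alpha>'>0. \<alpha> \<in> {\<nu>3 T * \<alpha>'..\<nu>5 T} \<and>
       (?m (?arc \<alpha>') > ?m ?x + \<nu>0 T * (?g \<bullet> (?arc \<alpha>' - ?x)) \<or> infnorm (?arc \<alpha>' - ?x) \<ge> \<nu>1 T * \<Delta>))"
    using bspec[OF cp[unfolded cauchy_point_def Let_def grad_block_model] k, folded w_def]
    by (elim exE conjE) (rule that; assumption)
  have s: "s = ?z - ?x" by (simp add: s_def block_diff)
  have ms: "?m ?x = model L x (x + w)" "?m ?z = model L x (x + (w + s))"
    by (simp_all add: block_model_eq w_def s block_diff)
  show thesis
  proof
    show "0 < \<alpha>" by (fact \<alpha>(1))
    show "\<alpha> \<le> \<nu>5 T" using \<alpha>(4) by (elim disjE exE conjE) simp_all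
    show "?z \<in> ?S" using arc_mem[of \<alpha>] unfolding \<alpha>(2)[symmetric] .
    show "(s + \<alpha> *\<^sub>R ?g) \<bullet> (?z - u) \<le> 0" if "u \<in> ?S" for u
      using arc_dot[OF that, of \<alpha>] unfolding \<alpha>(2)[symmetric] s by (simp add: algebra_simps)
    have "\<nu>0 T * (norm s)\<^sup>2 \<le> \<nu>0 T * (\<alpha> * - (?g \<bullet> s))"
      using arc_descent[of \<alpha>] params(7) unfolding \<alpha>(2)[symmetric] s by (intro mult_left_mono) auto
    also have "\<dots> = \<alpha> * (- \<nu>0 T * (?g \<bullet> s))" by simp
    also have "\<dots> \<le> \<alpha> * (model L x (x + w) - model L x (x + (w + s)))"
      using \<alpha>(1,3) unfolding ms s[symmetric] by (intro mult_left_mono) auto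
    finally show "\<nu>0 T * (norm s)\<^sup>2 \<le> \<alpha> * (model L x (x + w) - model L x (x + prefix P (Suc k) (z - x)))"
      by (simp add: prefix_Suc w_def s_def)
    show "min (\<nu>4 T) (\<nu>3 T * (2 * (1 - \<nu>0 T) / Bhat)) \<le> \<alpha> \<or> min 1 (\<nu>3 T) * \<nu>1 T * \<Delta> \<le> norm s"
      using \<alpha>(4)
    proof (elim disjE exE conjE)
      assume "\<alpha> \<in> {\<nu>4 T..\<nu>5 T}" then show ?thesis by auto
    next
      fix \<alpha>' assume \<alpha>': "\<alpha>' > 0" "\<alpha> \<in> {\<nu>3 T * \<alpha>'..\<nu>5 T}"
        and fail: "?m (?arc \<alpha>') > ?m ?x + \<nu>0 T * (?g \<bullet> (?arc \<alpha>' - ?x))"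
      \<comment> \<open>Failed sufficient decrease means that curvature outweighs the fraction
        \<open>1 - \<nu>0 T\<close> of the predicted linear decrease. Bounding curvature by
        \<open>Bhat\<close> and \<open>norm d\<close> by \<open>arc_descent\<close> leaves the same
        factor \<open>- (?g \<bullet> d)\<close> on both sides; cancelling it bounds
        \<open>\<alpha>'\<close> from below.\<close>
      define d where "d = ?arc \<alpha>' - ?x"
      have "(1 - \<nu>0 T) * - (?g \<bullet> d) < 1 / 2 * (d \<bullet> (hess L x *v d))"
        using fail m_arc[of \<alpha>'] by (simp add: d_def[symmetric] algebra_simps)
      also have "\<dots> \<le> 1 / 2 * (Bhat * (norm d)\<^sup>2)"
        using inner_hess_le[OF x, of d d] by (simp add: power2_eq_square)
      also have "\<dots> \<le> 1 / 2 * (Bhat * (\<alpha>' * - (?g \<bullet> d)))"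
        using arc_descent[of \<alpha>'] Bhat_pos unfolding d_def[symmetric] by (intro mult_left_mono) auto
      finally have lt: "(1 - \<nu>0 T) * - (?g \<bullet> d) < (Bhat / 2 * \<alpha>') * - (?g \<bullet> d)" by simp
      moreover have "0 \<le> - (?g \<bullet> d)"
        using order_trans[OF zero_le_power2 arc_descent[of \<alpha>']] \<alpha>'(1) unfolding d_def[symmetric]
        by (simp only: zero_le_mult_iff) linarith
      ultimately have "1 - \<nu>0 T < Bhat / 2 * \<alpha>'" by (rule mult_right_less_imp_less)
      then have "2 * (1 - \<nu>0 T) / Bhat \<le> \<alpha>'" using Bhat_pos by (simp add: divide_simps mult.commute)
      then have "\<nu>3 T * (2 * (1 - \<nu>0 T) / Bhat) \<le> \<nu>3 T * \<alpha>'"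
        using params by (intro mult_left_mono) auto
      then show ?thesis using \<alpha>' by auto
    next
      fix \<alpha>' assume \<alpha>': "\<alpha>' > 0" "\<alpha> \<in> {\<nu>3 T * \<alpha>'..\<nu>5 T}"
        and far: "infnorm (?arc \<alpha>' - ?x) \<ge> \<nu>1 T * \<Delta>"
      have far': "\<nu>1 T * \<Delta> \<le> norm (?arc \<alpha>' - ?x)"
        using far infnorm_le_norm by (rule order_trans)
      \<comment> \<open>If \<open>\<alpha>\<close> is at least \<open>\<alpha>'\<close>, the
        accepted displacement is the longer one. Otherwise \<open>\<alpha>\<close> is still at least
        \<open>\<nu>3 T * \<alpha>'\<close>, and displacement per step size does not increase along
        the arc, so at most the factor \<open>\<nu>3 T\<close> is lost.\<close>
      have "min 1 (\<nu>3 T) * norm (?arc \<alpha>' - ?x) \<le> norm s"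
      proof (cases "\<alpha>' \<le> \<alpha>")
        case True
        then have "norm (?arc \<alpha>' - ?x) \<le> norm s"
          unfolding s \<alpha>(2) arc using closest_point_arc_mono(1)[OF S xk \<alpha>'(1)] by blast
        moreover have "min 1 (\<nu>3 T) * norm (?arc \<alpha>' - ?x) \<le> 1 * norm (?arc \<alpha>' - ?x)"
          by (intro mult_right_mono) auto
        ultimately show ?thesis by linarith
      next
        case False
        then have "\<alpha> * norm (?arc \<alpha>' - ?x) \<le> \<alpha>' * norm s"
          unfolding s \<alpha>(2) arc using closest_point_arc_mono(2)[OF S xk \<alpha>(1)] by simp
        moreover have "\<nu>3 T * \<alpha>' * norm (?arc \<alpha>' - ?x) \<le> \<alpha> * norm (?arc \<alpha>' - ?x)"
          using \<alpha>' by (intro mult_right_mono) auto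
        ultimately have "\<alpha>' * (\<nu>3 T * norm (?arc \<alpha>' - ?x)) \<le> \<alpha>' * norm s" by (simp add: mult_ac)
        then have "\<nu>3 T * norm (?arc \<alpha>' - ?x) \<le> norm s" using \<alpha>'(1) by simp
        moreover have "min 1 (\<nu>3 T) * norm (?arc \<alpha>' - ?x) \<le> \<nu>3 T * norm (?arc \<alpha>' - ?x)"
          by (intro mult_right_mono) auto
        ultimately show ?thesis by linarith
      qed
      moreover have "min 1 (\<nu>3 T) * (\<nu>1 T * \<Delta>) \<le> min 1 (\<nu>3 T) * norm (?arc \<alpha>' - ?x)"
        using far' params by (intro mult_left_mono) auto
      ultimately show ?thesis by (simp add: mult.assoc)
    qed
  qed
qed

lemma cauchy_in_Omega:
  assumes "cauchy_point P T L x \<Delta> z" "x \<in> Omega P"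
  shows "z \<in> Omega P"
  unfolding Omega_def
proof (intro CollectI ballI)
  fix k assume "k \<in> {1..nblocks P}"
  then show "block P k z \<in> Omega_block P k" by (rule cauchy_block[OF assms])
qed

text \<open>The decreases of the blocks telescope along the sweep, and the squared block
  displacements add up because blocks are orthogonal. Each \<open>\<alpha>\<close> may be replaced
  by its upper bound \<open>\<nu>5 T\<close> since the decrease that it multiplies is
  nonnegative.\<close>

lemma cauchy_decrease:
  assumes "cauchy_point P T L x \<Delta> z" "x \<in> Omega P"
  shows "\<nu>0 T / \<nu>5 T * (norm (z - x))\<^sup>2 \<le> model L x x - model L x z"
proof -
  let ?m = "\<lambda>k. model L x (x + prefix P k (z - x))"
  have "\<nu>0 T / \<nu>5 T * (norm (block P k (z - x)))\<^sup>2 \<le> ?m k - ?m (Suc k)" if k: "k \<in> {1..nblocks P}" for k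
  proof -
    obtain \<alpha> where \<alpha>: "0 < \<alpha>" "\<alpha> \<le> \<nu>5 T"
      "\<nu>0 T * (norm (block P k (z - x)))\<^sup>2 \<le> \<alpha> * (?m k - ?m (Suc k))"
      by (rule cauchy_block[OF assms k]) (rule that; assumption)
    then have "0 \<le> \<alpha> * (?m k - ?m (Suc k))"
      using params by (smt (verit) mult_nonneg_nonneg zero_le_power2)
    then have "\<alpha> * (?m k - ?m (Suc k)) \<le> \<nu>5 T * (?m k - ?m (Suc k))"
      using \<alpha> by (intro mult_right_mono) (auto simp: zero_le_mult_iff)
    with \<alpha>(3) show ?thesis using params by (simp add: divide_simps mult.commute)
  qed
  then have "(\<Sum>k\<in>{1..nblocks P}. \<nu>0 T / \<nu>5 T * (norm (block P k (z - x)))\<^sup>2)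
      \<le> (\<Sum>k\<in>{1..nblocks P}. ?m k - ?m (Suc k))"
    by (rule sum_mono)
  also have "\<dots> = ?m 1 - ?m (Suc (nblocks P))"
    using sum_Suc_diff[of 1 "nblocks P" "\<lambda>k. - ?m k"] by simp
  finally show ?thesis
    by (simp only: sum_distrib_left[symmetric] sum_norm_block prefix_first prefix_last) simp
qed

text \<open>If no block moves, every block gradient is a block of \<open>grad L x\<close>, and each
  projection inequality is the criticality condition of its block. The product structure lets the
  conditions be summed.\<close>

lemma cauchy_fixed_critical:
  assumes cp: "cauchy_point P T L x \<Delta> x" and x: "x \<in> Omega P"
  shows "critical L (Omega P) x"
  unfolding critical_def normal_cone_def
proof (intro conjI CollectI ballI x)
  fix y assume y: "y \<in> Omega P"
  have "0 \<le> grad L x \<bullet> block P k (y - x)" if k: "k \<in> {1..nblocks P}" for k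
  proof -
    have z: "prefix P k 0 = 0" "block P k 0 = 0" by (simp_all add: prefix_def vec_eq_iff)
    obtain \<alpha> where \<alpha>: "0 < \<alpha>" "\<And>u. u \<in> Omega_block P k \<Longrightarrow>
        (\<alpha> *\<^sub>R block_grad P L x 0 k) \<bullet> (block P k x - u) \<le> 0"
      by (rule cauchy_block[OF cp x k]) (auto simp: z)
    have "\<alpha> * (grad L x \<bullet> block P k (x - y)) \<le> 0"
      using \<alpha>(2)[OF block_Omega[OF y k]] by (simp add: block_grad_def block_diff[symmetric] inner_block)
    then show ?thesis using \<alpha>(1) by (simp add: mult_le_0_iff block_diff inner_diff_right)
  qed
  then have "0 \<le> (\<Sum>k\<in>{1..nblocks P}. grad L x \<bullet> block P k (y - x))" by (rule sum_nonneg)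
  then show "- grad L x \<bullet> (y - x) \<le> 0"
    by (simp add: inner_sum_right[symmetric] sum_block del: One_nat_def)
qed

section \<open>Lipschitz gradient and length of the Cauchy step\<close>

lemma grad_has_derivative:
  "u \<in> Omega P \<Longrightarrow> (grad L has_derivative (\<lambda>h. hess L u *v h)) (at u)"
  using grad_differentiable[of u] unfolding hess_def jacobian_works .

lemma grad_lipschitz:
  assumes "x \<in> Omega P" "y \<in> Omega P"
  shows "norm (grad L x - grad L y) \<le> Bhat * norm (x - y)"
proof (rule differentiable_bound[OF convex_Omega _ hess_bound])
  fix u assume "u \<in> Omega P"
  then show "(grad L has_derivative (*v) (hess L u)) (at u within Omega P)"
    by (rule has_derivative_at_withinI[OF grad_has_derivative])
qed (use assms in auto)

text \<open>A nonexpansiveness argument block by block. The projection inequality for block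
  \<open>j\<close> is tested at the block of \<open>a\<close>, and criticality of \<open>a\<close>
  at \<open>a\<close> with its block replaced by that of \<open>z\<close>; together they bound the
  new block error by the old one plus a gradient difference. The latter sees the blocks already
  moved, hence the induction. The critical point \<open>a\<close> is quantified after
  \<open>C\<close> so that one constant serves every possible limit point.\<close>

lemma cauchy_prefix_bound:
  "\<exists>C\<ge>0. \<forall>x a z \<Delta>. x \<in> Omega P \<longrightarrow> critical L (Omega P) a \<longrightarrow> cauchy_point P T L x \<Delta> z \<longrightarrow>
     norm (prefix P j (z - x)) \<le> C * norm (x - a)"
proof (induction j)
  case 0
  show ?case by (intro exI[of _ 0]) (simp add: prefix_def vec_eq_iff zero_vec_def[symmetric])
next
  case (Suc j)
  then obtain C where C: "C \<ge> 0" "\<And>x a z \<Delta>. x \<in> Omega P \<Longrightarrow> critical L (Omega P) a \<Longrightarrow>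
      cauchy_point P T L x \<Delta> z \<Longrightarrow> norm (prefix P j (z - x)) \<le> C * norm (x - a)"
    by blast
  \<comment> \<open>The 2 counts the old block error twice, once in the bound for the new error and
    once in passing from errors to displacements; the rest is the step size bound times the gradient
    difference, whose second part comes from the earlier blocks.\<close>
  define C' where "C' = C + (2 + \<nu>5 T * (Bhat + Bhat * C))"
  have C': "C' \<ge> C" using C(1) params Bhat_pos by (simp add: C'_def)
  show ?case
  proof (intro exI[of _ C'] conjI allI impI)
    show "0 \<le> C'" using C' C(1) by simp
    fix x a z \<Delta> assume x: "x \<in> Omega P" and a: "critical L (Omega P) a" and cp: "cauchy_point P T L x \<Delta> z"
    let ?w = "prefix P j (z - x)" and ?e = "block P j (x - a)" and ?E = "block P j (z - a)"
    have aO: "a \<in> Omega P" using a by (simp add: critical_def)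
    have w: "norm ?w \<le> C * norm (x - a)" using C(2)[OF x a cp] .
    show "norm (prefix P (Suc j) (z - x)) \<le> C' * norm (x - a)"
    proof (cases "j \<in> {1..nblocks P}")
      case False
      \<comment> \<open>An index outside \<open>1..nblocks P\<close>, in particular 0, owns no
        coordinate.\<close>
      then have "block P j (z - x) = 0" using block_of_mem by (auto simp: vec_eq_iff)
      then show ?thesis unfolding prefix_Suc using w C'
        by simp (smt (verit) mult_right_mono norm_ge_zero)
    next
      case True
      let ?G = "block_grad P L x ?w j - block P j (grad L a)"
      obtain \<alpha> where \<alpha>: "0 < \<alpha>" "\<alpha> \<le> \<nu>5 T" "block P j z \<in> Omega_block P j"
        "\<And>u. u \<in> Omega_block P j \<Longrightarrow> (block P j (z - x) + \<alpha> *\<^sub>R block_grad P L x ?w j) \<bullet> (block P j z - u) \<le> 0"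
        by (rule cauchy_block[OF cp x True]) (rule that; assumption)
      have 1: "(block P j (z - x) + \<alpha> *\<^sub>R block_grad P L x ?w j) \<bullet> ?E \<le> 0"
        using \<alpha>(4)[OF block_Omega[OF aO True]] by (simp add: block_diff)
      have "- grad L a \<bullet> (a + (block P j z - block P j a) - a) \<le> 0"
        using a replace_block_Omega[OF aO \<alpha>(3)] unfolding critical_def normal_cone_def by blast
      then have "0 \<le> block P j (grad L a) \<bullet> ?E" by (simp add: inner_block block_diff)
      then have 2: "0 \<le> \<alpha> * (block P j (grad L a) \<bullet> ?E)" using \<alpha>(1) by simp
      have "block P j (z - x) = ?E - ?e" by (simp add: block_diff)
      \<comment> \<open>The sum of inequalities 1 and 2: the gradient at \<open>a\<close> drops out
        and only its deviation \<open>?G\<close> remains.\<close>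
      then have "?E \<bullet> ?E \<le> (?e - \<alpha> *\<^sub>R ?G) \<bullet> ?E"
        using 1 2 by (simp only: inner_add_left inner_diff_left inner_scaleR_left) (simp add: right_diff_distrib)
      also have "\<dots> \<le> norm (?e - \<alpha> *\<^sub>R ?G) * norm ?E" by (rule norm_cauchy_schwarz)
      finally have "norm ?E \<le> norm (?e - \<alpha> *\<^sub>R ?G)"
        by (cases "?E = 0") (auto simp: dot_square_norm power2_eq_square)
      also have "\<dots> \<le> norm (x - a) + \<alpha> * norm ?G"
        using norm_triangle_ineq4[of ?e "\<alpha> *\<^sub>R ?G"] norm_block_le[of P j "x - a"] \<alpha>(1) by simp
      also have "\<alpha> * norm ?G \<le> \<nu>5 T * (Bhat * norm (x - a) + Bhat * (C * norm (x - a)))"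
      proof (intro mult_mono \<alpha>(2))
        have "norm ?G \<le> norm (grad L x - grad L a) + Bhat * norm ?w"
          by (rule norm_block_grad_diff_le[OF hess_bound[OF x]])
        also have "\<dots> \<le> Bhat * norm (x - a) + Bhat * (C * norm (x - a))"
          using Bhat_pos by (intro add_mono grad_lipschitz x aO mult_left_mono w) auto
        finally show "norm ?G \<le> \<dots>" .
      qed (use params in auto)
      finally have "norm ?E \<le> norm (x - a) + \<nu>5 T * (Bhat * norm (x - a) + Bhat * (C * norm (x - a)))" by simp
      moreover have "norm (block P j (z - x)) \<le> norm ?E + norm (x - a)"
        using norm_triangle_ineq4[of ?E ?e] norm_block_le[of P j "x - a"] by (simp add: block_diff)
      ultimately have "norm (?w + block P j (z - x)) \<le> C * norm (x - a) +
          (norm (x - a) + \<nu>5 T * (Bhat * norm (x - a) + Bhat * (C * norm (x - a))) + norm (x - a))"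
        using w norm_triangle_ineq[of ?w "block P j (z - x)"] by linarith
      also have "\<dots> = C' * norm (x - a)" by (simp add: C'_def algebra_simps)
      finally show ?thesis by (simp add: prefix_Suc)
    qed
  qed
qed

lemma cauchy_step_bound:
  obtains C where "0 \<le> C" "\<And>x a z \<Delta>. x \<in> Omega P \<Longrightarrow> critical L (Omega P) a \<Longrightarrow>
    cauchy_point P T L x \<Delta> z \<Longrightarrow> norm (z - x) \<le> C * norm (x - a)"
  using cauchy_prefix_bound[of "Suc (nblocks P)"] unfolding prefix_last by blast

end

subsection \<open>Local behaviour at the limit point\<close>

text \<open>Riesz representation: the vector representing the derivative is its adjoint applied to
  1.\<close>

lemma GDERIV_grad:
  assumes "L differentiable (at x)"
  shows "GDERIV L x :> grad L x"
proof -
  obtain f' where f': "(L has_derivative f') (at x)" using assms by (auto simp: differentiable_def)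
  have "f' = (\<lambda>h. h \<bullet> adjoint f' 1)"
    using adjoint_works[OF has_derivative_linear[OF f'], of _ 1] by (simp add: fun_eq_iff)
  with f' have "GDERIV L x :> adjoint f' 1" by (simp add: gderiv_def)
  then show ?thesis by (simp add: grad_eqI)
qed

locale trap_limit =
  trap P T L Bhat
  for P :: "('n::finite) block_polyhedra" and T :: trap_params and L :: "real^'n \<Rightarrow> real" and Bhat :: real +
  fixes xs :: "real^'n" and \<kappa> :: real
  assumes nondegenerate: "nondegenerate L (Omega P) xs"
    and hess_continuous: "continuous (at xs within Omega P) (hess L)"
    and \<kappa>_pos: "0 < \<kappa>"
    and coercive: "\<And>v. v \<in> (normal_cone (Omega P) xs)\<^sup>\<bottom> \<Longrightarrow> v \<bullet> (hess L xs *v v) \<ge> \<kappa> * (norm v)\<^sup>2"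
begin

abbreviation V :: "(real^'n) set" where
  "V \<equiv> active_subspace P xs"

lemma xs_Omega: "xs \<in> Omega P"
  using nondegenerate by (simp add: nondegenerate_def)

lemma xs_critical: "critical L (Omega P) xs"
  using nondegenerate rel_interior_subset by (auto simp: nondegenerate_def critical_def)

lemma grad_xs_ge: "u \<in> Omega P \<Longrightarrow> 0 \<le> grad L xs \<bullet> (u - xs)"
  using xs_critical by (auto simp: critical_def normal_cone_def)

lemma active_subspace_feasible:
  obtains \<delta> where "0 < \<delta>" "\<And>v. v \<in> V \<Longrightarrow> norm v < \<delta> \<Longrightarrow> xs + v \<in> Omega P"
  by (rule tangent_directions_feasible[OF finite_constraints xs_Omega[unfolded Omega_eq],
        folded Omega_eq active_eq, folded active_subspace_eq]) (rule that; assumption)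

lemma active_stable:
  obtains \<delta> where "0 < \<delta>" "\<And>u. norm (u - xs) < \<delta> \<Longrightarrow> active P u \<subseteq> active P xs"
proof -
  obtain \<delta> where \<delta>: "0 < \<delta>" "\<And>j v. j \<in> constraints \<Longrightarrow> normal P (fst j) (snd j) \<bullet> xs < rhs P (fst j) (snd j) \<Longrightarrow>
      norm v < \<delta> \<Longrightarrow> normal P (fst j) (snd j) \<bullet> (xs + v) < rhs P (fst j) (snd j)"
    by (rule inactive_constraints_stable[OF finite_constraints,
          where \<omega> = "\<lambda>j. normal P (fst j) (snd j)" and h = "\<lambda>j. rhs P (fst j) (snd j)" and x = xs])
       (rule that; assumption)
  show thesis
  proof (rule that[OF \<delta>(1)], rule subsetI)
    fix u j assume u: "norm (u - xs) < \<delta>" and j: "j \<in> active P u"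
    then show "j \<in> active P xs"
      using \<delta>(2)[of j "u - xs"] xs_Omega by (auto simp: active_eq Omega_eq less_le)
  qed
qed

lemma subspace_V: "subspace V"
  by (auto simp: active_subspace_eq subspace_def inner_add_right)

text \<open>Small multiples of \<open>v\<close> of both signs are feasible, which forces equality.
  This is how coercivity on the complement of the normal cone becomes available on \<open>V\<close>,
  and why \<open>grad L xs\<close> vanishes there.\<close>

lemma V_orthogonal_normal_cone:
  assumes v: "v \<in> V" and w: "w \<in> normal_cone (Omega P) xs"
  shows "w \<bullet> v = 0"
proof (cases "v = 0")
  case False
  obtain \<delta> where \<delta>: "0 < \<delta>" "\<And>v. v \<in> V \<Longrightarrow> norm v < \<delta> \<Longrightarrow> xs + v \<in> Omega P"
    using active_subspace_feasible by blast
  define s where "s = \<delta> / (2 * norm v)"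
  have s: "s > 0" "norm (s *\<^sub>R v) < \<delta>" using False \<delta>(1) by (auto simp: s_def)
  have "xs + s *\<^sub>R v \<in> Omega P" "xs + (- s) *\<^sub>R v \<in> Omega P"
    using s v subspace_V by (intro \<delta>(2) subspace_scale; simp)+
  then have "w \<bullet> (xs + s *\<^sub>R v - xs) \<le> 0" "w \<bullet> (xs + (- s) *\<^sub>R v - xs) \<le> 0"
    using w unfolding normal_cone_def by blast+
  with s(1) show ?thesis by (simp add: mult_le_0_iff zero_le_mult_iff)
qed simp

lemma grad_xs_V: "v \<in> V \<Longrightarrow> grad L xs \<bullet> v = 0"
  using V_orthogonal_normal_cone[of v "- grad L xs"] xs_critical by (simp add: critical_def)

lemma coercive_V: "v \<in> V \<Longrightarrow> \<kappa> * (norm v)\<^sup>2 \<le> v \<bullet> (hess L xs *v v)"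
  by (intro coercive) (simp add: orthogonal_comp_def orthogonal_def V_orthogonal_normal_cone)

section \<open>Second-order approximation with both points varying near \<open>xs\<close>\<close>

lemma hess_near:
  assumes "0 < \<epsilon>"
  obtains r where "0 < r"
    "\<And>u v. u \<in> Omega P \<Longrightarrow> norm (u - xs) < r \<Longrightarrow> norm (hess L u *v v - hess L xs *v v) \<le> \<epsilon> * norm v"
proof -
  obtain r where r: "0 < r" "\<And>u. u \<in> Omega P \<Longrightarrow> dist u xs < r \<Longrightarrow> dist (hess L u) (hess L xs) < \<epsilon>"
    using hess_continuous assms unfolding continuous_within_eps_delta by blast
  show thesis
  proof (rule that[OF r(1)])
    fix u v assume "u \<in> Omega P" "norm (u - xs) < r"
    then have "norm (hess L u - hess L xs) \<le> \<epsilon>" using r(2)[of u] by (simp add: dist_norm)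
    then show "norm (hess L u *v v - hess L xs *v v) \<le> \<epsilon> * norm v"
      unfolding matrix_vector_mult_diff_rdistrib[symmetric]
      by (meson mult_right_mono norm_ge_zero norm_matrix_vector_mult_le order_trans)
  qed
qed

text \<open>Strict differentiability: the mean value bound is applied to \<open>grad L\<close> minus
  the fixed linear map \<open>hess L xs\<close>, on the convex set where the Hessian is close to
  \<open>hess L xs\<close>.\<close>

lemma grad_near:
  assumes "0 < \<epsilon>"
  obtains r where "0 < r"
    "\<And>x y. x \<in> Omega P \<Longrightarrow> y \<in> Omega P \<Longrightarrow> norm (x - xs) < r \<Longrightarrow> norm (y - xs) < r \<Longrightarrow>
       norm (grad L y - grad L x - hess L xs *v (y - x)) \<le> \<epsilon> * norm (y - x)"
proof -
  obtain r where r: "0 < r"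
    "\<And>u v. u \<in> Omega P \<Longrightarrow> norm (u - xs) < r \<Longrightarrow> norm (hess L u *v v - hess L xs *v v) \<le> \<epsilon> * norm v"
    using hess_near[OF assms] by metis
  let ?f = "\<lambda>u. grad L u - hess L xs *v u"
  have "norm (?f y - ?f x) \<le> \<epsilon> * norm (y - x)"
    if "x \<in> Omega P" "y \<in> Omega P" "norm (x - xs) < r" "norm (y - xs) < r" for x y
  proof (rule differentiable_bound)
    show "convex (Omega P \<inter> ball xs r)" by (intro convex_Int convex_Omega convex_ball)
    fix u assume u: "u \<in> Omega P \<inter> ball xs r"
    then have "u \<in> Omega P" "norm (u - xs) < r" by (auto simp: dist_norm norm_minus_commute)
    then show "onorm (\<lambda>h. hess L u *v h - hess L xs *v h) \<le> \<epsilon>"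
      using r(2) assms by (intro onorm_bound) auto
    have "(?f has_derivative (\<lambda>h. hess L u *v h - hess L xs *v h)) (at u)"
      using u by (intro has_derivative_diff grad_has_derivative
          bounded_linear.has_derivative[OF matrix_vector_mul_bounded_linear] has_derivative_ident) auto
    then show "(?f has_derivative (\<lambda>h. hess L u *v h - hess L xs *v h)) (at u within Omega P \<inter> ball xs r)"
      by (rule has_derivative_at_withinI)
  qed (use that in \<open>auto simp: dist_norm norm_minus_commute\<close>)
  then show thesis by (intro that[OF r(1)]) (simp add: matrix_vector_mult_diff_distrib algebra_simps)
qed

lemma model_near:
  assumes "0 < \<epsilon>"
  obtains r where "0 < r"
    "\<And>x y. x \<in> Omega P \<Longrightarrow> y \<in> Omega P \<Longrightarrow> norm (x - xs) < r \<Longrightarrow> norm (y - xs) < r \<Longrightarrow>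
       \<bar>L y - model L x y\<bar> \<le> \<epsilon> * (norm (y - x))\<^sup>2"
proof -
  have e: "0 < \<epsilon> / 2" using assms by simp
  obtain r1 where r1: "0 < r1"
    "\<And>u v. u \<in> Omega P \<Longrightarrow> norm (u - xs) < r1 \<Longrightarrow> norm (hess L u *v v - hess L xs *v v) \<le> \<epsilon> / 2 * norm v"
    using hess_near[OF e] by metis
  obtain r2 where r2: "0 < r2"
    "\<And>x y. x \<in> Omega P \<Longrightarrow> y \<in> Omega P \<Longrightarrow> norm (x - xs) < r2 \<Longrightarrow> norm (y - xs) < r2 \<Longrightarrow>
       norm (grad L y - grad L x - hess L xs *v (y - x)) \<le> \<epsilon> / 2 * norm (y - x)"
    using grad_near[OF e] by metis
  show thesis
  proof
    show "0 < min r1 r2" using r1 r2 by simp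
    fix x y assume xy: "x \<in> Omega P" "y \<in> Omega P" "norm (x - xs) < min r1 r2" "norm (y - xs) < min r1 r2"
    define p where "p = y - x"
    \<comment> \<open>The error of the model along the segment, up to the constant
      \<open>L x\<close>, so \<open>\<phi> 1 - \<phi> 0\<close> is the quantity wanted. In its
      derivative half of \<open>\<epsilon>\<close> pays for linearising the gradient at
      \<open>xs\<close> and half for exchanging \<open>hess L xs\<close> with
      \<open>hess L x\<close>.\<close>
    define \<phi> where "\<phi> t = L (x + t *\<^sub>R p) - t * (grad L x \<bullet> p) - t\<^sup>2 / 2 * (p \<bullet> (hess L x *v p))" for t
    define \<phi>' where "\<phi>' t = grad L (x + t *\<^sub>R p) \<bullet> p - grad L x \<bullet> p - t * (p \<bullet> (hess L x *v p))" for t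
    have seg: "x + t *\<^sub>R p \<in> Omega P" "norm (x + t *\<^sub>R p - xs) < min r1 r2" if "0 \<le> t" "t \<le> 1" for t
    proof -
      have eq: "x + t *\<^sub>R p = (1 - t) *\<^sub>R x + t *\<^sub>R y" by (simp add: p_def algebra_simps)
      show "x + t *\<^sub>R p \<in> Omega P"
        unfolding eq using convexD[OF convex_Omega xy(1,2), of "1 - t" t] that by simp
      have "x + t *\<^sub>R p \<in> ball xs (min r1 r2)"
        unfolding eq using convexD[OF convex_ball, of x xs "min r1 r2" y "1 - t" t] xy that
        by (simp add: dist_norm norm_minus_commute)
      then show "norm (x + t *\<^sub>R p - xs) < min r1 r2" by (simp add: dist_norm norm_minus_commute)
    qed
    have "DERIV \<phi> t :> \<phi>' t" if "0 \<le> t" "t \<le> 1" for t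
    proof -
      have "(L has_derivative (\<lambda>h. h \<bullet> grad L (x + t *\<^sub>R p))) (at (x + t *\<^sub>R p))"
        using GDERIV_grad[OF L_differentiable[OF seg(1)[OF that]]] by (simp add: gderiv_def)
      then have "((\<lambda>t. L (x + t *\<^sub>R p)) has_derivative (\<lambda>h. (h *\<^sub>R p) \<bullet> grad L (x + t *\<^sub>R p))) (at t)"
        by (rule has_derivative_compose[rotated]) (auto intro!: derivative_eq_intros)
      then have "DERIV (\<lambda>t. L (x + t *\<^sub>R p)) t :> grad L (x + t *\<^sub>R p) \<bullet> p"
        by (rule has_derivative_imp_has_field_derivative) (simp add: inner_commute mult.commute)
      then show ?thesis
        unfolding \<phi>_def \<phi>'_def by (auto intro!: derivative_eq_intros)
    qed
    then obtain t where t: "0 < t" "t < 1" "\<phi> 1 - \<phi> 0 = (1 - 0) * \<phi>' t"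
      using MVT2[of 0 1 \<phi> \<phi>'] by auto
    have tt: "0 \<le> t" "t \<le> 1" using t by auto
    have "\<phi>' t = (grad L (x + t *\<^sub>R p) - grad L x - hess L xs *v (t *\<^sub>R p)) \<bullet> p
        - t * ((hess L x *v p - hess L xs *v p) \<bullet> p)"
      by (simp add: \<phi>'_def inner_diff_left matrix_vector_mult_scaleR inner_commute algebra_simps)
    also have "\<bar>\<dots>\<bar> \<le> \<epsilon> / 2 * norm (t *\<^sub>R p) * norm p + t * (\<epsilon> / 2 * norm p * norm p)"
    proof (rule order_trans[OF abs_triangle_ineq4 add_mono])
      have "norm (grad L (x + t *\<^sub>R p) - grad L x - hess L xs *v (t *\<^sub>R p)) \<le> \<epsilon> / 2 * norm (t *\<^sub>R p)"
        using r2(2)[of x "x + t *\<^sub>R p"] xy seg[OF tt] by simp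
      then show "\<bar>(grad L (x + t *\<^sub>R p) - grad L x - hess L xs *v (t *\<^sub>R p)) \<bullet> p\<bar> \<le> \<epsilon> / 2 * norm (t *\<^sub>R p) * norm p"
        by (rule order_trans[OF Cauchy_Schwarz_ineq2 mult_right_mono]) simp
      have "norm (hess L x *v p - hess L xs *v p) \<le> \<epsilon> / 2 * norm p"
        using r1(2)[of x] xy by simp
      then have "\<bar>(hess L x *v p - hess L xs *v p) \<bullet> p\<bar> \<le> \<epsilon> / 2 * norm p * norm p"
        by (rule order_trans[OF Cauchy_Schwarz_ineq2 mult_right_mono]) simp
      then show "\<bar>t * ((hess L x *v p - hess L xs *v p) \<bullet> p)\<bar> \<le> t * (\<epsilon> / 2 * norm p * norm p)"
        unfolding abs_mult abs_of_nonneg[OF tt(1)] by (rule mult_left_mono[OF _ tt(1)])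
    qed
    also have "\<dots> = t * (\<epsilon> * (norm p)\<^sup>2)" using tt by (simp add: power2_eq_square)
    also have "\<dots> \<le> 1 * (\<epsilon> * (norm p)\<^sup>2)" using tt assms by (intro mult_right_mono) auto
    finally have "\<bar>\<phi> 1 - \<phi> 0\<bar> \<le> \<epsilon> * (norm p)\<^sup>2" using t(3) by simp
    moreover have "\<phi> 1 - \<phi> 0 = L y - model L x y"
      by (simp add: \<phi>_def model_def p_def)
    ultimately show "\<bar>L y - model L x y\<bar> \<le> \<epsilon> * (norm (y - x))\<^sup>2" by (simp add: p_def)
  qed
qed

section \<open>Growth, identification and the size of trial steps\<close>

lemma face_split:
  obtains c \<delta> where "0 < c" "0 < \<delta>"
    "\<And>u. u \<in> Omega P \<Longrightarrow> norm (u - xs) < \<delta> \<Longrightarrow>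
       \<exists>v\<in>V. norm v \<le> norm (u - xs) \<and> xs + v \<in> Omega P \<and> c * norm (u - xs - v) \<le> grad L xs \<bullet> (u - xs)"
proof -
  let ?\<omega> = "\<lambda>j. normal P (fst j) (snd j)" and ?h = "\<lambda>j. rhs P (fst j) (snd j)"
  have ri: "- grad L xs \<in> rel_interior (normal_cone (Omega P) xs)"
    using nondegenerate by (simp add: nondegenerate_def)
  show thesis
    by (rule nondegenerate_face_split[OF finite_constraints xs_Omega[unfolded Omega_eq] ri[unfolded Omega_eq],
          folded Omega_eq active_eq, folded active_subspace_eq])
       (rule that; assumption)
qed

text \<open>
  Growth is linear across the face of \<open>xs\<close>, by strict complementarity, and quadratic along it,
  by coercivity of the Hessian.
\<close>

lemma quadratic_growth:
  obtains c r where "0 < c" "0 < r"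
    "\<And>u. u \<in> Omega P \<Longrightarrow> norm (u - xs) < r \<Longrightarrow> L xs + c * (norm (u - xs))\<^sup>2 \<le> L u"
proof -
  obtain c \<delta> where c: "0 < c" "0 < \<delta>" "\<And>u. u \<in> Omega P \<Longrightarrow> norm (u - xs) < \<delta> \<Longrightarrow>
       \<exists>v\<in>V. norm v \<le> norm (u - xs) \<and> xs + v \<in> Omega P \<and> c * norm (u - xs - v) \<le> grad L xs \<bullet> (u - xs)"
    using face_split by metis
  have "0 < \<kappa> / 16" using \<kappa>_pos by simp
  then obtain r where r: "0 < r"
    "\<And>x y. x \<in> Omega P \<Longrightarrow> y \<in> Omega P \<Longrightarrow> norm (x - xs) < r \<Longrightarrow> norm (y - xs) < r \<Longrightarrow>
       \<bar>L y - model L x y\<bar> \<le> \<kappa> / 16 * (norm (y - x))\<^sup>2"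
    using model_near by metis
  \<comment> \<open>Within this radius the linear growth \<open>c * norm w\<close> absorbs all terms
    that mix \<open>norm e\<close> with the transversal part \<open>w\<close>.\<close>
  define r' where "r' = min (min r \<delta>) (c / (4 * Bhat + 2 * \<kappa>))"
  have r': "0 < r'" using r c Bhat_pos \<kappa>_pos by (simp add: r'_def)
  show thesis
  proof
    \<comment> \<open>Coercivity along the face contributes \<open>\<kappa> / 4\<close> times the
      squared distance, of which the model error takes \<open>\<kappa> / 16\<close>; the remaining
      \<open>3 * \<kappa> / 16\<close> exceeds this constant.\<close>
    show "0 < \<kappa> / 8" using \<kappa>_pos by simp
    show "0 < r'" by fact
    fix u assume u: "u \<in> Omega P" and near: "norm (u - xs) < r'"
    let ?H = "hess L xs"
    define e where "e = u - xs"
    obtain v where v: "v \<in> V" "norm v \<le> norm e" "c * norm (e - v) \<le> grad L xs \<bullet> e"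
      using c(3)[OF u] near by (auto simp: r'_def e_def)
    define w where "w = e - v"
    have w: "norm w \<le> 2 * norm e" using norm_triangle_ineq4[of e v] v(2) by (simp add: w_def)
    have small: "norm e * (4 * Bhat + 2 * \<kappa>) \<le> c"
      using near Bhat_pos \<kappa>_pos by (simp add: r'_def e_def pos_less_divide_eq)
    have "L xs + grad L xs \<bullet> e + 1 / 2 * (e \<bullet> (?H *v e)) - \<kappa> / 16 * (norm e)\<^sup>2 \<le> L u"
    proof -
      have "\<bar>L u - model L xs u\<bar> \<le> \<kappa> / 16 * (norm e)\<^sup>2"
        using r(2)[OF xs_Omega u] near r(1) by (simp add: e_def r'_def)
      then show ?thesis unfolding model_def e_def[symmetric] by linarith
    qed
    moreover have "e \<bullet> (?H *v e) = v \<bullet> (?H *v v) + (v \<bullet> (?H *v w) + w \<bullet> (?H *v e))"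
    proof -
      have "e = v + w" by (simp add: w_def)
      then show ?thesis by (simp add: matrix_vector_right_distrib inner_add_left inner_add_right)
    qed
    moreover have "- (v \<bullet> (?H *v w)) \<le> Bhat * norm e * norm w"
      using inner_hess_le[OF xs_Omega, of v w] v(2) Bhat_pos
      by (smt (verit) mult_right_mono mult_left_mono norm_ge_zero)
    moreover have "- (w \<bullet> (?H *v e)) \<le> Bhat * norm e * norm w"
      using inner_hess_le[OF xs_Omega, of w e] by (simp add: mult_ac abs_le_iff)
    moreover have "Bhat * norm e * norm w + (Bhat * norm e * norm w + (\<kappa> * norm e * norm w)) \<le> c * norm w"
    proof -
      have "Bhat * norm e * norm w + (Bhat * norm e * norm w + (\<kappa> * norm e * norm w))
          = norm e * (2 * Bhat + \<kappa>) * norm w" by (simp add: algebra_simps)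
      also have "\<dots> \<le> norm e * (4 * Bhat + 2 * \<kappa>) * norm w"
        using Bhat_pos \<kappa>_pos by (intro mult_right_mono mult_left_mono) auto
      also have "\<dots> \<le> c * norm w" using small by (intro mult_right_mono) auto
      finally show ?thesis .
    qed
    moreover have "\<kappa> * (norm w)\<^sup>2 \<le> 2 * (\<kappa> * norm e * norm w)"
    proof -
      have "norm w * norm w \<le> 2 * norm e * norm w" using w by (rule mult_right_mono) simp
      from mult_left_mono[OF this, of \<kappa>] show ?thesis using \<kappa>_pos by (simp add: power2_eq_square mult_ac)
    qed
    moreover have "(norm e)\<^sup>2 \<le> 2 * (norm v)\<^sup>2 + 2 * (norm w)\<^sup>2"
    proof -
      have "norm e \<le> norm v + norm w" using norm_triangle_ineq[of v w] by (simp add: w_def)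
      then have "(norm e)\<^sup>2 \<le> (norm v + norm w)\<^sup>2" by (rule power_mono) simp
      also have "\<dots> \<le> 2 * (norm v)\<^sup>2 + 2 * (norm w)\<^sup>2"
        using sum_squares_bound[of "norm v" "norm w"] by (simp add: power2_sum)
      finally show ?thesis .
    qed
    then have "\<kappa> * (norm e)\<^sup>2 \<le> 2 * (\<kappa> * (norm v)\<^sup>2) + 2 * (\<kappa> * (norm w)\<^sup>2)"
      using mult_left_mono[of "(norm e)\<^sup>2" _ \<kappa>] \<kappa>_pos by (fastforce simp: distrib_left)
    moreover have "\<kappa> * (norm v)\<^sup>2 \<le> v \<bullet> (?H *v v)" by (rule coercive_V[OF v(1)])
    moreover have "0 \<le> \<kappa> * (norm e)\<^sup>2" "0 \<le> Bhat * norm e * norm w" using \<kappa>_pos Bhat_pos by simp_all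
    ultimately show "L xs + \<kappa> / 8 * (norm (u - xs))\<^sup>2 \<le> L u"
      using v(3) unfolding w_def[symmetric] e_def[symmetric] by linarith
  qed
qed

text \<open>If \<open>z\<close> misses an active constraint of \<open>xs\<close> in block
  \<open>k\<close>, the objective at \<open>xs\<close> has slope at least \<open>c\<close> along the
  transversal part of that block. A projected step of size at least \<open>\<alpha>min\<close> would
  have to be long to stop against such a slope, yet near \<open>xs\<close> it is short. Hence the
  step size is small, and the Cauchy search allows this only if the displacement is comparable to
  the radius.\<close>

lemma identification:
  obtains \<delta> where "0 < \<delta>"
    "\<And>x z \<Delta>. x \<in> Omega P \<Longrightarrow> cauchy_point P T L x \<Delta> z \<Longrightarrow> norm (x - xs) < \<delta> \<Longrightarrow> norm (z - xs) < \<delta> \<Longrightarrow>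
       active P xs \<subseteq> active P z \<or> min 1 (\<nu>3 T) * \<nu>1 T * \<Delta> \<le> norm (z - x)"
proof -
  obtain c \<delta>0 where c: "0 < c" "0 < \<delta>0" "\<And>u. u \<in> Omega P \<Longrightarrow> norm (u - xs) < \<delta>0 \<Longrightarrow>
       \<exists>v\<in>V. norm v \<le> norm (u - xs) \<and> xs + v \<in> Omega P \<and> c * norm (u - xs - v) \<le> grad L xs \<bullet> (u - xs)"
    using face_split by metis
  define \<alpha>min where "\<alpha>min = min (\<nu>4 T) (\<nu>3 T * (2 * (1 - \<nu>0 T) / Bhat))"
  have \<alpha>min: "0 < \<alpha>min" using params Bhat_pos by (simp add: \<alpha>min_def)
  \<comment> \<open>The second bound makes the gradient deviation, below
    \<open>3 * Bhat * \<delta>\<close>, at most \<open>c / 2\<close>; the third makes the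
    displacement, below \<open>2 * \<delta>\<close>, at most \<open>\<alpha>min * c / 2\<close>.
    These contradict each other at the end.\<close>
  define \<delta> where "\<delta> = min \<delta>0 (min (c / (6 * Bhat)) (\<alpha>min * c / 4))"
  have \<delta>: "0 < \<delta>" "\<delta> \<le> \<delta>0" "6 * Bhat * \<delta> \<le> c" "4 * \<delta> \<le> \<alpha>min * c"
  proof -
    show "0 < \<delta>" "\<delta> \<le> \<delta>0" using c \<alpha>min Bhat_pos by (auto simp: \<delta>_def)
    have "\<delta> \<le> c / (6 * Bhat)" "\<delta> \<le> \<alpha>min * c / 4" by (auto simp: \<delta>_def)
    then show "6 * Bhat * \<delta> \<le> c" "4 * \<delta> \<le> \<alpha>min * c" using Bhat_pos by (simp_all add: pos_le_divide_eq mult.commute)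
  qed
  show thesis
  proof (rule that[OF \<delta>(1)])
    fix x z \<Delta> assume x: "x \<in> Omega P" and cp: "cauchy_point P T L x \<Delta> z"
      and near: "norm (x - xs) < \<delta>" "norm (z - xs) < \<delta>"
    have zO: "z \<in> Omega P" by (rule cauchy_in_Omega[OF cp x])
    have zx: "norm (z - x) < 2 * \<delta>"
      using near norm_triangle_ineq4[of "z - xs" "x - xs"] by simp
    show "active P xs \<subseteq> active P z \<or> min 1 (\<nu>3 T) * \<nu>1 T * \<Delta> \<le> norm (z - x)"
    proof (rule disjCI, rule subsetI, rule ccontr)
      fix j assume small: "\<not> min 1 (\<nu>3 T) * \<nu>1 T * \<Delta> \<le> norm (z - x)"
        and j: "j \<in> active P xs" "j \<notin> active P z"
      obtain k i where ki: "j = (k, i)" by (cases j)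
      have con: "(k, i) \<in> constraints" using j ki by (simp add: active_eq)
      then have k: "k \<in> {1..nblocks P}" by (simp add: constraints_def)
      let ?g = "grad L xs"
      define e where "e = block P k (z - xs)"
      have "xs + e \<in> Omega P"
        using replace_block_Omega[OF xs_Omega block_Omega[OF zO k]] by (simp add: e_def block_diff)
      moreover have "norm e < \<delta>0"
        using norm_block_le[of P k "z - xs"] near \<delta>(2) by (simp add: e_def)
      ultimately obtain v where v: "v \<in> V" "xs + v \<in> Omega P" "c * norm (e - v) \<le> ?g \<bullet> e"
        using c(3)[of "xs + e"] by auto
      have "e \<noteq> v"
      proof
        assume "e = v"
        then have "normal P k i \<bullet> e = 0" using v(1) j(1) ki by (auto simp: active_subspace_eq)
        then have "normal P k i \<bullet> z = normal P k i \<bullet> xs"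
          by (simp add: e_def normal_inner_block[OF con] inner_diff_right)
        then show False using j ki con by (simp add: active_eq)
      qed
      \<comment> \<open>The projection inequality of block \<open>k\<close> sees that block only,
        while \<open>v\<close> may leave it. Resetting block \<open>k\<close> of
        \<open>xs + v\<close> to that of \<open>xs\<close> keeps feasibility, so block
        \<open>k\<close> of \<open>v\<close> cannot have positive slope; dropping the other blocks
        therefore preserves the lower bound.\<close>
      define d where "d = block P k (e - v)"
      have "xs + v + (block P k xs - block P k (xs + v)) \<in> Omega P"
        by (rule replace_block_Omega[OF v(2) block_Omega[OF xs_Omega k]])
      then have "0 \<le> ?g \<bullet> (v - block P k v)"
        using grad_xs_ge by (fastforce simp: block_add algebra_simps)
      then have "?g \<bullet> block P k v \<le> 0" using grad_xs_V[OF v(1)] by (simp add: inner_diff_right)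
      then have gd: "c * norm (e - v) \<le> ?g \<bullet> d"
        using v(3) by (simp add: d_def block_diff e_def inner_diff_right)
      then have d0: "d \<noteq> 0" using \<open>e \<noteq> v\<close> c(1)
        by (metis eq_iff_diff_eq_0 inner_zero_right mult_pos_pos not_le zero_less_norm_iff)
      have gd': "c * norm d \<le> ?g \<bullet> d"
        using gd norm_block_le[of P k "e - v"] c(1) unfolding d_def
        by (meson mult_le_cancel_left_pos order_trans)
      define s where "s = block P k (z - x)"
      define G where "G = block_grad P L x (prefix P k (z - x)) k - block P k ?g"
      obtain \<alpha> where \<alpha>: "0 < \<alpha>"
        "\<And>u. u \<in> Omega_block P k \<Longrightarrow> (s + \<alpha> *\<^sub>R block_grad P L x (prefix P k (z - x)) k) \<bullet> (block P k z - u) \<le> 0"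
        "\<alpha>min \<le> \<alpha> \<or> min 1 (\<nu>3 T) * \<nu>1 T * \<Delta> \<le> norm s"
        by (rule cauchy_block[OF cp x k, folded s_def \<alpha>min_def]) (rule that; assumption)
      have ns: "norm s \<le> norm (z - x)" by (simp add: s_def norm_block_le)
      then have a: "\<alpha>min \<le> \<alpha>" using \<alpha>(3) small by linarith
      have "block P k z - block P k (xs + v) = d"
        by (simp add: d_def e_def block_diff block_add)
      then have "(s + \<alpha> *\<^sub>R (G + block P k ?g)) \<bullet> d \<le> 0"
        using \<alpha>(2)[OF block_Omega[OF v(2) k]] by (simp add: G_def)
      moreover have "block P k ?g \<bullet> d = ?g \<bullet> d" by (simp add: inner_block d_def)
      ultimately have "\<alpha> * (?g \<bullet> d) \<le> - (s + \<alpha> *\<^sub>R G) \<bullet> d"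
        by (simp add: inner_add_left algebra_simps)
      also have "\<dots> \<le> norm (s + \<alpha> *\<^sub>R G) * norm d"
        using Cauchy_Schwarz_ineq2[of "s + \<alpha> *\<^sub>R G" d] unfolding inner_minus_left by linarith
      also have "\<dots> \<le> (norm s + \<alpha> * norm G) * norm d"
        using norm_triangle_ineq[of s "\<alpha> *\<^sub>R G"] \<alpha>(1) by (intro mult_right_mono) auto
      finally have "(\<alpha> * c) * norm d \<le> (norm s + \<alpha> * norm G) * norm d"
        using mult_left_mono[OF gd' less_imp_le[OF \<alpha>(1)]] by (simp only: mult.assoc)
      then have *: "\<alpha> * c \<le> norm s + \<alpha> * norm G" using d0 by simp
      have "norm G \<le> norm (grad L x - ?g) + Bhat * norm (prefix P k (z - x))"
        unfolding G_def by (rule norm_block_grad_diff_le[OF hess_bound[OF x]])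
      also have "\<dots> \<le> Bhat * norm (x - xs) + Bhat * norm (z - x)"
        using Bhat_pos by (intro add_mono grad_lipschitz x xs_Omega mult_left_mono prefix_norm_le) auto
      also have "\<dots> < Bhat * \<delta> + Bhat * (2 * \<delta>)"
        using near zx Bhat_pos by (intro add_strict_mono mult_strict_left_mono) auto
      finally have "norm G < c / 2" using \<delta>(3) by simp
      then have "\<alpha> * norm G \<le> \<alpha> * (c / 2)" using \<alpha>(1) by (intro mult_left_mono) auto
      with * have "\<alpha> * c / 2 \<le> norm s" by simp
      moreover have "\<alpha>min * c \<le> \<alpha> * c" using a c(1) by simp
      ultimately show False using ns zx \<delta>(4) by linarith
    qed
  qed
qed

text \<open>On the identified face \<open>y - z\<close> is tangent, and the model does not increase
  along it. Its slope there is of order \<open>norm (x - xs)\<close>, as \<open>grad L xs\<close>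
  vanishes on \<open>V\<close>, so coercivity bounds the correction. In the other case the radius is
  bounded by a multiple of the Cauchy displacement and limits \<open>y - x\<close> directly.\<close>

lemma refinement_step_bound:
  obtains C \<delta> where "0 \<le> C" "0 < \<delta>"
    "\<And>x \<Delta> z \<sigma> y. x \<in> Omega P \<Longrightarrow> cauchy_point P T L x \<Delta> z \<Longrightarrow> refinement P T L x \<Delta> z \<sigma> y \<Longrightarrow> 0 \<le> \<sigma> \<Longrightarrow>
       norm (x - xs) < \<delta> \<Longrightarrow> norm (y - x) \<le> C * norm (x - xs)"
proof -
  obtain Cz where Cz: "0 \<le> Cz" "\<And>x a z \<Delta>. x \<in> Omega P \<Longrightarrow> critical L (Omega P) a \<Longrightarrow>
    cauchy_point P T L x \<Delta> z \<Longrightarrow> norm (z - x) \<le> Cz * norm (x - a)"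
    using cauchy_step_bound by metis
  obtain \<delta>1 where \<delta>1: "0 < \<delta>1"
    "\<And>x z \<Delta>. x \<in> Omega P \<Longrightarrow> cauchy_point P T L x \<Delta> z \<Longrightarrow> norm (x - xs) < \<delta>1 \<Longrightarrow> norm (z - xs) < \<delta>1 \<Longrightarrow>
       active P xs \<subseteq> active P z \<or> min 1 (\<nu>3 T) * \<nu>1 T * \<Delta> \<le> norm (z - x)"
    using identification by metis
  \<comment> \<open>Half of the coercivity survives the passage from \<open>hess L xs\<close> to
    \<open>hess L x\<close>.\<close>
  have "0 < \<kappa> / 2" using \<kappa>_pos by simp
  then obtain \<delta>2 where \<delta>2: "0 < \<delta>2"
    "\<And>u v. u \<in> Omega P \<Longrightarrow> norm (u - xs) < \<delta>2 \<Longrightarrow> norm (hess L u *v v - hess L xs *v v) \<le> \<kappa> / 2 * norm v"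
    using hess_near by metis
  define c1 where "c1 = min 1 (\<nu>3 T) * \<nu>1 T"
  have c1: "0 < c1" using params by (simp add: c1_def)
  define n where "n = sqrt DIM(real^'n)"
  have n: "0 \<le> n" by (simp add: n_def)
  define \<delta> where "\<delta> = min \<delta>2 (\<delta>1 / (1 + Cz))"
  have \<delta>: "0 < \<delta>" "\<delta> \<le> \<delta>2" "(1 + Cz) * \<delta> \<le> \<delta>1"
  proof -
    show "0 < \<delta>" "\<delta> \<le> \<delta>2" using \<delta>1(1) \<delta>2(1) Cz(1) by (auto simp: \<delta>_def)
    have "\<delta> \<le> \<delta>1 / (1 + Cz)" by (simp add: \<delta>_def)
    then show "(1 + Cz) * \<delta> \<le> \<delta>1" using Cz(1) by (simp add: pos_le_divide_eq mult.commute)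
  qed
  define Cq where "Cq = 4 / \<kappa> * (Bhat + Bhat * Cz)"
  define Cd where "Cd = n * (\<gamma>2 T * (Cz / c1))"
  have Cq: "0 \<le> Cq" "0 \<le> Cd" using \<kappa>_pos Bhat_pos Cz(1) c1 params n by (auto simp: Cq_def Cd_def)
  show thesis
  proof
    show "0 \<le> Cz + Cq + Cd" using Cz(1) Cq by simp
    show "0 < \<delta>" by fact
    fix x \<Delta> z \<sigma> y
    assume x: "x \<in> Omega P" and cp: "cauchy_point P T L x \<Delta> z" and ref: "refinement P T L x \<Delta> z \<sigma> y"
      and \<sigma>: "0 \<le> \<sigma>" and near: "norm (x - xs) < \<delta>"
    let ?H = "hess L x"
    have zx: "norm (z - x) \<le> Cz * norm (x - xs)" by (rule Cz(2)[OF x xs_critical cp])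
    have "norm (z - xs) \<le> norm (z - x) + norm (x - xs)"
      using norm_triangle_ineq[of "z - x" "x - xs"] by simp
    also have "\<dots> \<le> (1 + Cz) * norm (x - xs)" using zx by (simp add: algebra_simps)
    also have "\<dots> < (1 + Cz) * \<delta>" using near Cz(1) by (intro mult_strict_left_mono) auto
    finally have z_near: "norm (z - xs) < \<delta>1" using \<delta>(3) by linarith
    have "1 * \<delta> \<le> (1 + Cz) * \<delta>" using Cz(1) \<delta>(1) by (intro mult_right_mono) auto
    then have x_near: "norm (x - xs) < \<delta>1" using near \<delta>(3) by linarith
    from \<delta>1(2)[OF x cp x_near z_near] show "norm (y - x) \<le> (Cz + Cq + Cd) * norm (x - xs)"
    proof
      assume id: "active P xs \<subseteq> active P z"
      define q where "q = y - z"
      define w where "w = z - x"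
      have "active P z \<subseteq> active P y" using ref unfolding refinement_def active_def by blast
      then have q: "q \<in> V"
        using id by (fastforce simp: active_subspace_eq active_eq q_def inner_diff_right)
      have "model L x y \<le> model L x z" using ref \<sigma> unfolding refinement_def
        by (smt (verit) mult_nonneg_nonneg zero_le_power2 divide_nonneg_nonneg)
      moreover have "y = x + (w + q)" "z = x + w" by (simp_all add: w_def q_def)
      moreover define h where "h = (1 / 2) *\<^sub>R (?H *v w + w v* ?H)"
      ultimately have "1 / 2 * (q \<bullet> (?H *v q)) \<le> - ((grad L x + h) \<bullet> q)"
        using model_add[of L x w q] by simp
      also have "\<dots> = - ((grad L x - grad L xs + h) \<bullet> q)"
        using grad_xs_V[OF q] by (simp add: algebra_simps)
      also have "\<dots> \<le> norm (grad L x - grad L xs + h) * norm q"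
        using Cauchy_Schwarz_ineq2[of "grad L x - grad L xs + h" q] by linarith
      also have "\<dots> \<le> ((Bhat + Bhat * Cz) * norm (x - xs)) * norm q"
      proof (rule mult_right_mono)
        have "norm h \<le> Bhat * norm w"
          unfolding h_def by (rule norm_symmetrised_hess_le[OF hess_bound[OF x]])
        also have "\<dots> \<le> Bhat * (Cz * norm (x - xs))"
          using zx Bhat_pos by (simp add: w_def)
        finally show "norm (grad L x - grad L xs + h) \<le> (Bhat + Bhat * Cz) * norm (x - xs)"
          using grad_lipschitz[OF x xs_Omega] norm_triangle_ineq[of "grad L x - grad L xs" h]
          by (simp add: algebra_simps)
      qed simp
      finally have up: "1 / 2 * (q \<bullet> (?H *v q)) \<le> ((Bhat + Bhat * Cz) * norm (x - xs)) * norm q" .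
      have "norm (?H *v q - hess L xs *v q) \<le> \<kappa> / 2 * norm q"
        using near \<delta>(2) by (intro \<delta>2(2) x) simp
      then have "- (q \<bullet> (?H *v q - hess L xs *v q)) \<le> \<kappa> / 2 * norm q * norm q"
        using norm_cauchy_schwarz[of "- q" "?H *v q - hess L xs *v q"]
          mult_left_mono[of "norm (?H *v q - hess L xs *v q)" _ "norm q"] by (fastforce simp: mult_ac)
      then have "\<kappa> / 4 * (norm q * norm q) \<le> 1 / 2 * (q \<bullet> (?H *v q))"
        using coercive_V[OF q] by (simp add: inner_diff_right power2_eq_square)
      with up have "(\<kappa> / 4 * norm q) * norm q \<le> ((Bhat + Bhat * Cz) * norm (x - xs)) * norm q"
        by (simp add: mult.assoc)
      then have "\<kappa> / 4 * norm q \<le> (Bhat + Bhat * Cz) * norm (x - xs)"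
        using Bhat_pos Cz(1) by (cases "q = 0") (auto intro!: mult_nonneg_nonneg add_nonneg_nonneg)
      then have "norm q \<le> Cq * norm (x - xs)"
        using \<kappa>_pos by (simp add: Cq_def field_simps)
      moreover have "norm (y - x) \<le> norm w + norm q"
        using norm_triangle_ineq[of w q] by (simp add: w_def q_def)
      moreover have "0 \<le> Cd * norm (x - xs)" using Cq by simp
      ultimately show ?thesis using zx by (simp add: w_def algebra_simps)
    next
      assume "min 1 (\<nu>3 T) * \<nu>1 T * \<Delta> \<le> norm (z - x)"
      then have "c1 * \<Delta> \<le> Cz * norm (x - xs)" using zx by (simp add: c1_def)
      then have "\<Delta> \<le> Cz / c1 * norm (x - xs)" using c1 by (simp add: field_simps)
      then have "\<gamma>2 T * \<Delta> \<le> \<gamma>2 T * (Cz / c1 * norm (x - xs))"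
        using params(6) by (intro mult_left_mono) auto
      then have "infnorm (y - x) \<le> \<gamma>2 T * (Cz / c1 * norm (x - xs))"
        using ref by (simp add: refinement_def)
      then have "n * infnorm (y - x) \<le> Cd * norm (x - xs)"
        unfolding Cd_def using mult_left_mono[OF _ n] by (simp only: mult.assoc)
      then have "norm (y - x) \<le> Cd * norm (x - xs)"
        using norm_le_infnorm[of "y - x"] by (simp add: n_def)
      moreover have "0 \<le> (Cz + Cq) * norm (x - xs)" using Cz Cq by simp
      ultimately show ?thesis by (simp add: algebra_simps)
    qed
  qed
qed

end

subsection \<open>Convergence of the iterates\<close>

locale trap_iterates =
  trap_limit P T L Bhat xs \<kappa>
  for P :: "('n::finite) block_polyhedra" and T :: trap_params and L :: "real^'n \<Rightarrow> real" and Bhat :: real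
    and xs :: "real^'n" and \<kappa> :: real +
  fixes \<sigma>lo \<sigma>hi :: real and x0 :: "real^'n" and x :: "nat \<Rightarrow> real^'n" and \<Delta> :: "nat \<Rightarrow> real"
    and z y :: "nat \<Rightarrow> real^'n" and \<sigma> :: "nat \<Rightarrow> real"
  assumes x0: "x0 \<in> Omega P"
    and \<sigma>lo_pos: "0 < \<sigma>lo"
    and run: "trap_run P T \<sigma>lo \<sigma>hi L x0 x \<Delta> z y \<sigma>"
    and limit_point: "limit_point x xs"
begin

lemma cauchy: "cauchy_point P T L (x l) (\<Delta> l) (z l)"
  and refine: "refinement P T L (x l) (\<Delta> l) (z l) (\<sigma> l) (y l)"
  and update: "trap_update T L (x l) (\<Delta> l) (y l) (x (Suc l)) (\<Delta> (Suc l))"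
  and not_critical: "\<not> critical L (Omega P) (x l)"
  and \<sigma>_bounds: "\<sigma>lo < \<sigma> l" "\<sigma> l < \<sigma>hi"
  using run by (auto simp: trap_run_def)

lemma y_Omega: "y l \<in> Omega P"
  using refine by (simp add: refinement_def)

lemma x_Suc: "x (Suc l) = x l \<or> x (Suc l) = y l"
  using update[of l] unfolding trap_update_def Let_def by (auto simp: not_less)

lemma x_Omega: "x l \<in> Omega P"
proof (induction l)
  case 0
  then show ?case using run x0 by (simp add: trap_run_def)
next
  case (Suc l)
  then show ?case using x_Suc[of l] y_Omega[of l] by auto
qed

lemma \<Delta>_pos: "0 < \<Delta> l"
proof (induction l)
  case 0
  then show ?case using run params by (simp add: trap_run_def)
next
  case (Suc l)
  have "0 < \<sigma>1 T * \<Delta> l" using Suc params by simp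
  then show ?case using update[of l] Suc unfolding trap_update_def Let_def
    by (smt (verit) atLeastAtMost_iff)
qed

text \<open>The minimum combines the decrease rates of the Cauchy step and of the regularised
  refinement; the outer factor 1/2 comes from splitting the squared norm of a sum of the two
  displacements.\<close>

definition decrease_const :: real where
  "decrease_const = min (\<nu>0 T / \<nu>5 T) (\<sigma>lo / 2) / 2"

lemma decrease_const_pos: "0 < decrease_const"
  using params \<sigma>lo_pos by (simp add: decrease_const_def)

text \<open>The regularisation turns the refinement step into a step with quadratic model decrease.\<close>

lemma model_decrease:
  "decrease_const * (norm (y l - x l))\<^sup>2 \<le> model L (x l) (x l) - model L (x l) (y l)"
proof -
  let ?d = decrease_const and ?w = "norm (z l - x l)" and ?q = "norm (y l - z l)"
  have "norm (y l - x l) \<le> ?w + ?q"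
    using norm_triangle_ineq[of "z l - x l" "y l - z l"] by simp
  then have "(norm (y l - x l))\<^sup>2 \<le> (?w + ?q)\<^sup>2" by (rule power_mono) simp
  also have "\<dots> \<le> 2 * ?w\<^sup>2 + 2 * ?q\<^sup>2"
    using sum_squares_bound[of ?w ?q] by (simp add: power2_sum)
  finally have "?d * (norm (y l - x l))\<^sup>2 \<le> ?d * (2 * ?w\<^sup>2 + 2 * ?q\<^sup>2)"
    using decrease_const_pos by (intro mult_left_mono) auto
  also have "\<dots> = (2 * ?d) * ?w\<^sup>2 + (2 * ?d) * ?q\<^sup>2" by (simp add: algebra_simps)
  also have "\<dots> \<le> \<nu>0 T / \<nu>5 T * ?w\<^sup>2 + \<sigma> l / 2 * ?q\<^sup>2"
  proof (intro add_mono mult_right_mono)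
    have d: "2 * ?d = min (\<nu>0 T / \<nu>5 T) (\<sigma>lo / 2)" by (simp add: decrease_const_def)
    show "2 * ?d \<le> \<nu>0 T / \<nu>5 T" unfolding d by (rule min.cobounded1)
    have "2 * ?d \<le> \<sigma>lo / 2" unfolding d by (rule min.cobounded2)
    then show "2 * ?d \<le> \<sigma> l / 2" using \<sigma>_bounds[of l] by simp
  qed simp_all
  also have "\<dots> \<le> model L (x l) (x l) - model L (x l) (y l)"
    using cauchy_decrease[OF cauchy x_Omega, of l] refine[of l] by (simp add: refinement_def)
  finally show ?thesis .
qed

text \<open>A null step would force the Cauchy decrease, hence the Cauchy step, to vanish, and the
  iterate would be critical. This gives the acceptance ratio a positive denominator.\<close>

lemma step_nonzero: "y l \<noteq> x l"
proof
  assume eq: "y l = x l"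
  have "0 \<le> \<sigma> l / 2 * (norm (y l - z l))\<^sup>2" using \<sigma>_bounds[of l] \<sigma>lo_pos by simp
  then have "model L (x l) (x l) \<le> model L (x l) (z l)"
    using refine[of l] unfolding refinement_def eq by linarith
  then have "\<nu>0 T / \<nu>5 T * (norm (z l - x l))\<^sup>2 \<le> 0"
    using cauchy_decrease[OF cauchy x_Omega, of l] by linarith
  then have "z l = x l" using params by (simp add: mult_le_0_iff divide_le_0_iff)
  then show False
    using cauchy_fixed_critical[of "x l" "\<Delta> l"] cauchy[of l] x_Omega not_critical by metis
qed

lemma model_decrease_pos: "0 < model L (x l) (x l) - model L (x l) (y l)"
proof -
  have "0 < decrease_const * (norm (y l - x l))\<^sup>2"
    using decrease_const_pos step_nonzero[of l] by simp
  then show ?thesis using model_decrease[of l] by linarith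
qed

lemma objective_decrease:
  "\<eta>1 T * decrease_const * (norm (x (Suc l) - x l))\<^sup>2 \<le> L (x l) - L (x (Suc l))"
proof (cases "x (Suc l) = x l")
  case False
  let ?M = "model L (x l) (x l) - model L (x l) (y l)"
  have "\<eta>1 T \<le> (L (x l) - L (y l)) / ?M" "x (Suc l) = y l"
    using update[of l] False x_Suc[of l] unfolding trap_update_def Let_def by (auto simp: not_less[symmetric])
  then have "\<eta>1 T * ?M \<le> L (x l) - L (x (Suc l))"
    using model_decrease_pos[of l] by (simp add: pos_le_divide_eq)
  moreover have "\<eta>1 T * (decrease_const * (norm (x (Suc l) - x l))\<^sup>2) \<le> \<eta>1 T * ?M"
    using model_decrease[of l] params \<open>x (Suc l) = y l\<close> by (intro mult_left_mono) auto
  ultimately show ?thesis by (simp add: mult.assoc)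
qed simp

lemma objective_decseq: "decseq (\<lambda>l. L (x l))"
proof (rule decseq_SucI)
  fix l
  have "0 \<le> \<eta>1 T * decrease_const * (norm (x (Suc l) - x l))\<^sup>2"
    using params decrease_const_pos by (intro mult_nonneg_nonneg) auto
  then show "L (x (Suc l)) \<le> L (x l)" using objective_decrease[of l] by linarith
qed

lemma objective_tendsto: "(\<lambda>l. L (x l)) \<longlonglongrightarrow> L xs"
  and objective_ge: "L xs \<le> L (x l)"
proof -
  obtain r where r: "strict_mono r" "(x \<circ> r) \<longlonglongrightarrow> xs" using limit_point by (auto simp: limit_point_def)
  have "isCont L xs"
    using L_differentiable[OF xs_Omega] differentiable_imp_continuous_within by blast
  then have sub: "(\<lambda>l. L (x (r l))) \<longlonglongrightarrow> L xs"
    using isCont_tendsto_compose[OF _ r(2)] by (simp add: o_def)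
  have "decseq (\<lambda>l. L (x (r l)))"
    using objective_decseq r(1) by (simp add: decseq_def strict_mono_less_eq)
  then have "L xs \<le> L (x (r l))" for l by (rule decseq_ge[OF _ sub])
  then show ge: "L xs \<le> L (x l)" for l
    using objective_decseq seq_suble[OF r(1), of l] unfolding decseq_def by (meson order_trans)
  obtain b where b: "(\<lambda>l. L (x l)) \<longlonglongrightarrow> b"
    using decseq_convergent[OF objective_decseq, of "L xs"] ge by blast
  then have "(\<lambda>l. L (x (r l))) \<longlonglongrightarrow> b"
    using LIMSEQ_subseq_LIMSEQ[OF b r(1)] by (simp add: o_def)
  then have "b = L xs" using sub by (rule LIMSEQ_unique)
  with b show "(\<lambda>l. L (x l)) \<longlonglongrightarrow> L xs" by simp
qed

text \<open>
  Since successive iterates get close, the iterates cannot cross the annulus that separates the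
  strict local minimiser \<open>xs\<close> from other points of the same level.
\<close>

lemma x_converges: "x \<longlonglongrightarrow> xs"
proof -
  obtain c R where c: "0 < c" "0 < R"
    "\<And>u. u \<in> Omega P \<Longrightarrow> norm (u - xs) < R \<Longrightarrow> L xs + c * (norm (u - xs))\<^sup>2 \<le> L u"
    using quadratic_growth by metis
  \<comment> \<open>With one constant for growth and for decrease, a single threshold on
    \<open>L (x l) - L xs\<close> makes both the next step and the distance to \<open>xs\<close>
    shorter than \<open>R / 2\<close>.\<close>
  define a where "a = min c (\<eta>1 T * decrease_const)"
  have a: "0 < a" "a \<le> c" "a \<le> \<eta>1 T * decrease_const"
    using c params decrease_const_pos by (auto simp: a_def)
  have "0 < a * (R / 2)\<^sup>2" using a c by simp
  then have "\<forall>\<^sub>F l in sequentially. L (x l) - L xs < a * (R / 2)\<^sup>2"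
    using objective_tendsto by (intro order_tendstoD(2)[where y = 0]) (simp_all add: LIM_zero)
  then obtain N where N: "\<And>l. l \<ge> N \<Longrightarrow> L (x l) - L xs < a * (R / 2)\<^sup>2"
    by (auto simp: eventually_sequentially)
  have small: "t < R / 2" if "b * t\<^sup>2 < a * (R / 2)\<^sup>2" "a \<le> b" for b t :: real
  proof -
    have "a * t\<^sup>2 < a * (R / 2)\<^sup>2" using that mult_right_mono[of a b "t\<^sup>2"] by simp
    then have "t\<^sup>2 < (R / 2)\<^sup>2" using a(1) by simp
    then show ?thesis by (rule power_less_imp_less_base) (use c(2) in simp)
  qed
  have step: "norm (x (Suc l) - x l) < R / 2" if "l \<ge> N" for l
    using small[OF _ a(3)] objective_decrease[of l] objective_ge[of "Suc l"] N[OF that] by simp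
  have inner: "norm (x l - xs) < R / 2" if "l \<ge> N" "norm (x l - xs) < R" for l
    using small[OF _ a(2)] c(3)[OF x_Omega that(2)] N[OF that(1)] by simp
  obtain r where r: "strict_mono r" "(x \<circ> r) \<longlonglongrightarrow> xs" using limit_point by (auto simp: limit_point_def)
  then have "\<forall>\<^sub>F k in sequentially. norm (x (r k) - xs) < R"
    using c(2) by (auto simp: tendsto_iff dist_norm)
  then obtain k where k: "k \<ge> N" "norm (x (r k) - xs) < R"
    by (metis (mono_tags, lifting) eventually_sequentially nat_le_linear)
  define n where "n = r k"
  have n: "n \<ge> N" "norm (x n - xs) < R"
    using k seq_suble[OF r(1), of k] by (auto simp: n_def)
  \<comment> \<open>Inside the ball the distance is in fact below \<open>R / 2\<close>, and one more
    step adds less than \<open>R / 2\<close>.\<close>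
  have ball: "norm (x l - xs) < R" if "l \<ge> n" for l
    using that
  proof (induction l rule: dec_induct)
    case base
    then show ?case by (rule n(2))
  next
    case (step l)
    have "norm (x (Suc l) - x l) < R / 2" "norm (x l - xs) < R / 2"
      using \<open>\<And>l. l \<ge> N \<Longrightarrow> norm (x (Suc l) - x l) < R / 2\<close> inner step n by auto
    then show ?case using norm_triangle_ineq[of "x (Suc l) - x l" "x l - xs"] by simp
  qed
  have "(\<lambda>l. sqrt ((L (x l) - L xs) / c)) \<longlonglongrightarrow> sqrt ((L xs - L xs) / c)"
    by (intro tendsto_intros objective_tendsto) (use c in auto)
  then have "(\<lambda>l. sqrt ((L (x l) - L xs) / c)) \<longlonglongrightarrow> 0" by simp
  moreover have "\<forall>\<^sub>F l in sequentially. norm (x l - xs) \<le> sqrt ((L (x l) - L xs) / c)"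
  proof (rule eventually_sequentiallyI)
    fix l assume "l \<ge> n"
    then show "norm (x l - xs) \<le> sqrt ((L (x l) - L xs) / c)"
      using c(3)[OF x_Omega ball] c(1) by (intro real_le_rsqrt) (simp add: field_simps)
  qed
  ultimately have "(\<lambda>l. x l - xs) \<longlonglongrightarrow> 0"
    by (rule Lim_null_comparison[rotated])
  then show ?thesis by (rule LIM_zero_cancel)
qed

lemma eventually_x_near: "0 < r \<Longrightarrow> \<forall>\<^sub>F l in sequentially. norm (x l - xs) < r"
  using x_converges by (auto simp: tendsto_iff dist_norm)

lemma step_tendsto_0: "(\<lambda>l. y l - x l) \<longlonglongrightarrow> 0"
proof -
  obtain C \<delta> where C: "0 \<le> C" "0 < \<delta>"
    "\<And>x \<Delta> z \<sigma> y. x \<in> Omega P \<Longrightarrow> cauchy_point P T L x \<Delta> z \<Longrightarrow> refinement P T L x \<Delta> z \<sigma> y \<Longrightarrow> 0 \<le> \<sigma> \<Longrightarrow>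
       norm (x - xs) < \<delta> \<Longrightarrow> norm (y - x) \<le> C * norm (x - xs)"
    using refinement_step_bound by metis
  have lim: "(\<lambda>l. C * norm (x l - xs)) \<longlonglongrightarrow> 0"
    using x_converges by (intro tendsto_mult_right_zero tendsto_norm_zero) (simp add: LIM_zero)
  have "\<forall>\<^sub>F l in sequentially. norm (y l - x l) \<le> C * norm (x l - xs)"
    using eventually_x_near[OF C(2)]
  proof eventually_elim
    case (elim l)
    have "0 \<le> \<sigma> l" using \<sigma>_bounds(1)[of l] \<sigma>lo_pos by simp
    then show ?case by (rule C(3)[OF x_Omega cauchy refine _ elim])
  qed
  then show ?thesis by (rule Lim_null_comparison[OF _ lim])
qed

lemma y_converges: "y \<longlonglongrightarrow> xs"
  using tendsto_add[OF step_tendsto_0 x_converges] by simp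

lemma cauchy_step_tendsto_0: "(\<lambda>l. z l - x l) \<longlonglongrightarrow> 0"
proof -
  obtain C where C: "0 \<le> C" "\<And>x a z \<Delta>. x \<in> Omega P \<Longrightarrow> critical L (Omega P) a \<Longrightarrow>
    cauchy_point P T L x \<Delta> z \<Longrightarrow> norm (z - x) \<le> C * norm (x - a)"
    using cauchy_step_bound by metis
  have lim: "(\<lambda>l. C * norm (x l - xs)) \<longlonglongrightarrow> 0"
    using x_converges by (intro tendsto_mult_right_zero tendsto_norm_zero) (simp add: LIM_zero)
  show ?thesis
    by (rule Lim_null_comparison[OF _ lim]) (simp add: C(2)[OF x_Omega xs_critical cauchy])
qed

lemma z_converges: "z \<longlonglongrightarrow> xs"
  using tendsto_add[OF cauchy_step_tendsto_0 x_converges] by simp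

lemma eventually_very_successful:
  "\<forall>\<^sub>F l in sequentially. x (Suc l) = y l \<and> \<Delta> l \<le> \<Delta> (Suc l)"
proof -
  \<comment> \<open>Model error and predicted decrease are both of order
    \<open>(norm p)\<^sup>2\<close>; this choice keeps the error within half of what the test
    against \<open>\<eta>2 T\<close> tolerates.\<close>
  define \<epsilon> where "\<epsilon> = (1 - \<eta>2 T) * decrease_const / 2"
  have "0 < \<epsilon>" using params decrease_const_pos by (simp add: \<epsilon>_def)
  then obtain r where r: "0 < r"
    "\<And>x y. x \<in> Omega P \<Longrightarrow> y \<in> Omega P \<Longrightarrow> norm (x - xs) < r \<Longrightarrow> norm (y - xs) < r \<Longrightarrow>
       \<bar>L y - model L x y\<bar> \<le> \<epsilon> * (norm (y - x))\<^sup>2"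
    using model_near by metis
  have "\<forall>\<^sub>F l in sequentially. norm (y l - xs) < r"
    using y_converges r(1) by (auto simp: tendsto_iff dist_norm)
  with eventually_x_near[OF r(1)] show ?thesis
  proof eventually_elim
    case (elim l)
    let ?M = "model L (x l) (x l) - model L (x l) (y l)"
    have "\<bar>L (y l) - model L (x l) (y l)\<bar> \<le> \<epsilon> * (norm (y l - x l))\<^sup>2"
      using elim by (intro r(2) x_Omega y_Omega)
    also have "\<dots> = (1 - \<eta>2 T) / 2 * (decrease_const * (norm (y l - x l))\<^sup>2)" by (simp add: \<epsilon>_def)
    also have "\<dots> \<le> (1 - \<eta>2 T) / 2 * ?M"
      using model_decrease[of l] params by (intro mult_left_mono) auto
    also have "\<dots> < (1 - \<eta>2 T) * ?M"
      using model_decrease_pos[of l] params by (intro mult_strict_right_mono) auto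
    finally have "L (y l) - model L (x l) (y l) < (1 - \<eta>2 T) * ?M" by linarith
    moreover have "model L (x l) (x l) = L (x l)" by (simp add: model_def)
    ultimately have "\<eta>2 T * ?M < L (x l) - L (y l)" by (simp add: algebra_simps)
    then have "\<eta>2 T < (L (x l) - L (y l)) / ?M"
      using model_decrease_pos[of l] by (simp add: pos_less_divide_eq)
    then show ?case using update[of l] unfolding trap_update_def Let_def by auto
  qed
qed

lemma \<Delta>_bounded_below:
  obtains \<Delta>min where "0 < \<Delta>min" "\<forall>\<^sub>F l in sequentially. \<Delta>min \<le> \<Delta> l"
proof -
  obtain N where N: "\<And>l. l \<ge> N \<Longrightarrow> \<Delta> l \<le> \<Delta> (Suc l)"
    using eventually_very_successful by (auto simp: eventually_sequentially)
  have "\<Delta> N \<le> \<Delta> l" if "l \<ge> N" for l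
    using that by (induction l rule: dec_induct) (use N in \<open>auto intro: order_trans\<close>)
  then show thesis using that[OF \<Delta>_pos[of N]] by (auto simp: eventually_sequentially)
qed

lemma eventually_active_subset:
  assumes "u \<longlonglongrightarrow> xs"
  shows "\<forall>\<^sub>F l in sequentially. active P (u l) \<subseteq> active P xs"
proof -
  obtain \<delta> where \<delta>: "0 < \<delta>" "\<And>u. norm (u - xs) < \<delta> \<Longrightarrow> active P u \<subseteq> active P xs"
    using active_stable by blast
  have "\<forall>\<^sub>F l in sequentially. norm (u l - xs) < \<delta>"
    using assms \<delta>(1) by (auto simp: tendsto_iff dist_norm)
  then show ?thesis by eventually_elim (rule \<delta>(2))
qed

text \<open>The Cauchy step vanishes while the radius does not, which excludes the second
  alternative of \<open>identification\<close>. The refinement passes the active set from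
  \<open>z\<close> to \<open>y\<close>, and acceptance passes it on to the next iterate.\<close>

lemma eventually_identified:
  "\<forall>\<^sub>F l in sequentially. active P (z l) = active P xs \<and> active P (y l) = active P xs \<and> active P (x l) = active P xs"
proof -
  obtain \<delta> where \<delta>: "0 < \<delta>"
    "\<And>x z \<Delta>. x \<in> Omega P \<Longrightarrow> cauchy_point P T L x \<Delta> z \<Longrightarrow> norm (x - xs) < \<delta> \<Longrightarrow> norm (z - xs) < \<delta> \<Longrightarrow>
       active P xs \<subseteq> active P z \<or> min 1 (\<nu>3 T) * \<nu>1 T * \<Delta> \<le> norm (z - x)"
    using identification by metis
  obtain \<Delta>min where \<Delta>min: "0 < \<Delta>min" "\<forall>\<^sub>F l in sequentially. \<Delta>min \<le> \<Delta> l"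
    by (rule \<Delta>_bounded_below)
  let ?c = "min 1 (\<nu>3 T) * \<nu>1 T"
  have c: "0 < ?c" using params by simp
  have "\<forall>\<^sub>F l in sequentially. norm (z l - x l) < ?c * \<Delta>min"
    using tendsto_norm_zero[OF cauchy_step_tendsto_0] c \<Delta>min(1) by (intro order_tendstoD(2)[where y = 0]) auto
  moreover have "\<forall>\<^sub>F l in sequentially. norm (z l - xs) < \<delta>"
    using z_converges \<delta>(1) by (auto simp: tendsto_iff dist_norm)
  ultimately have z: "\<forall>\<^sub>F l in sequentially. active P xs \<subseteq> active P (z l)"
    using eventually_x_near[OF \<delta>(1)] \<Delta>min(2)
  proof eventually_elim
    case (elim l)
    have "?c * \<Delta>min \<le> ?c * \<Delta> l" using elim(4) c by (intro mult_left_mono) auto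
    then show ?case using \<delta>(2)[OF x_Omega cauchy elim(3,2)] elim(1) by linarith
  qed
  have sub: "active P (z l) \<subseteq> active P (y l)" for l
    using refine[of l] unfolding refinement_def active_def by blast
  have zy: "\<forall>\<^sub>F l in sequentially. active P (z l) = active P xs \<and> active P (y l) = active P xs"
    using z eventually_active_subset[OF y_converges]
    by eventually_elim (use sub in blast)
  have "\<forall>\<^sub>F l in sequentially. active P (x (Suc l)) = active P xs"
    using zy eventually_very_successful by eventually_elim simp
  then have "\<forall>\<^sub>F l in sequentially. active P (x l) = active P xs"
    by (simp only: eventually_sequentially_Suc[of "\<lambda>l. active P (x l) = active P xs"])
  with zy show ?thesis by eventually_elim simp
qed

text \<open>The new error lies in \<open>V\<close>, so coercivity can be tested against the
  projected Newton residual. That residual is the exact equation at \<open>xs\<close> plus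
  linearisation errors and regularisation terms; those proportional to the new error move to the
  left side.\<close>

lemma rate:
  assumes Cz: "\<And>l. norm (z l - x l) \<le> Cz * norm (x l - xs)"
    and basis: "\<And>l. orthonormal_basis_of (Z l) (active_subspace P (z l))"
    and inexact: "inexact_refinement P L \<gamma>s \<xi> x \<Delta> z y \<sigma> Z"
    and "0 < \<gamma>s" "0 < \<epsilon>" and \<xi>: "\<And>l. 0 < \<xi> l"
  shows "\<forall>\<^sub>F l in sequentially. (\<kappa> - \<epsilon> - \<sigma>hi / 2) * norm (x (Suc l) - xs)
           \<le> (\<xi> l * Bhat + 2 * \<epsilon> + \<sigma>hi * (Cz + 1 / 2)) * norm (x l - xs)"
proof -
  obtain r1 where r1: "0 < r1"
    "\<And>x y. x \<in> Omega P \<Longrightarrow> y \<in> Omega P \<Longrightarrow> norm (x - xs) < r1 \<Longrightarrow> norm (y - xs) < r1 \<Longrightarrow>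
       norm (grad L y - grad L x - hess L xs *v (y - x)) \<le> \<epsilon> * norm (y - x)"
    using grad_near[OF \<open>0 < \<epsilon>\<close>] by metis
  obtain r2 where r2: "0 < r2"
    "\<And>u v. u \<in> Omega P \<Longrightarrow> norm (u - xs) < r2 \<Longrightarrow> norm (hess L u *v v - hess L xs *v v) \<le> \<epsilon> * norm v"
    using hess_near[OF \<open>0 < \<epsilon>\<close>] by metis
  obtain \<Delta>min where \<Delta>min: "0 < \<Delta>min" "\<forall>\<^sub>F l in sequentially. \<Delta>min \<le> \<Delta> l"
    by (rule \<Delta>_bounded_below)
  have "\<forall>\<^sub>F l in sequentially. norm (y l - x l) < \<gamma>s * \<Delta>min"
    using tendsto_norm_zero[OF step_tendsto_0] \<Delta>min(1) \<open>0 < \<gamma>s\<close> by (intro order_tendstoD(2)[where y = 0]) auto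
  then show ?thesis
    using eventually_x_near[OF r1(1)] eventually_x_near[OF r2(1)] \<Delta>min(2) eventually_identified
      eventually_very_successful
  proof eventually_elim
    case (elim l)
    define p where "p = y l - x l"
    define e where "e = x l - xs"
    define e' where "e' = y l - xs"
    define w where "w = z l - x l"
    let ?H = "hess L xs" and ?g = "grad L xs"
    have e': "e' = e + p" by (simp add: e'_def e_def p_def)
    have V: "active_subspace P (z l) = V" using elim by (simp add: active_subspace_eq)
    have "normal P (fst j) (snd j) \<bullet> e' = 0" if "j \<in> active P xs" for j
    proof -
      have "j \<in> active P (y l)" using elim that by simp
      with that show ?thesis by (simp add: e'_def active_eq inner_diff_right)
    qed
    then have "e' \<in> V" by (simp add: active_subspace_eq)
    \<comment> \<open>After identification all the matrices \<open>Z l\<close> project onto the same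
      space \<open>V\<close>. Vanishing steps and a radius bounded below make the premises of the
      inexactness condition hold for every \<open>\<gamma>s > 0\<close>.\<close>
    note ZZ = orthonormal_ZZt[OF basis[of l, unfolded V]]
    have "infnorm p \<le> norm p" by (rule infnorm_le_norm)
    also have "\<dots> \<le> \<gamma>s * \<Delta>min" using elim by (simp add: p_def)
    also have "\<dots> \<le> \<gamma>s * \<Delta> l" using elim \<open>0 < \<gamma>s\<close> by simp
    finally have "infnorm p \<le> \<gamma>s * \<Delta> l" .
    moreover have "active P (x l) = active P (x l + p)" using elim by (simp add: p_def)
    moreover define R where "R = grad_reg L (\<sigma> l) (x l) (z l) + hess_reg L (\<sigma> l) (x l) *v p"
    ultimately have res: "norm (ZZt (Z l) R) \<le> \<xi> l * norm (ZZt (Z l) (grad L (x l)))"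
      using inexact unfolding inexact_refinement_def Let_def p_def R_def by blast
    \<comment> \<open>Hence the right side of the inexactness condition is of order
      \<open>norm e\<close>, by the Lipschitz bound on the gradient.\<close>
    have "ZZt (Z l) ?g = 0"
    proof -
      have "ZZt (Z l) ?g \<bullet> ZZt (Z l) ?g = 0"
        using ZZ(1)[OF ZZ(2), of ?g ?g] grad_xs_V[OF ZZ(2), of ?g] by (simp add: inner_commute)
      then show ?thesis by simp
    qed
    then have "ZZt (Z l) (grad L (x l)) = ZZt (Z l) (grad L (x l) - ?g)"
      by (simp add: ZZt_def inner_diff_right scaleR_diff_left sum_subtractf)
    also have "norm \<dots> \<le> Bhat * norm e"
      unfolding e_def by (rule order_trans[OF ZZ(3) grad_lipschitz[OF x_Omega xs_Omega]])
    finally have res': "norm (ZZt (Z l) R) \<le> \<xi> l * (Bhat * norm e)"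
      using order_trans[OF res mult_left_mono] \<xi>[of l] by (auto intro: less_imp_le)
    define d1 where "d1 = grad L (x l) - ?g - ?H *v e"
    define d2 where "d2 = hess L (x l) *v p - ?H *v p"
    have d1: "norm d1 \<le> \<epsilon> * norm e"
      unfolding d1_def e_def using elim r1(1) by (intro r1(2) xs_Omega x_Omega) auto
    have d2: "norm d2 \<le> \<epsilon> * norm p"
      unfolding d2_def using elim by (intro r2(2) x_Omega) auto
    \<comment> \<open>The regularised gradient contributes \<open>- w\<close> and the regularised
      Hessian half of \<open>p\<close>, both scaled by \<open>\<sigma> l\<close>. This term need not
      be small relative to the error, so the rate is limited by \<open>\<sigma>hi\<close>.\<close>
    have R: "R = ?g + ?H *v e' + (d1 + d2 + \<sigma> l *\<^sub>R ((1 / 2) *\<^sub>R p - w))"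
      by (simp add: R_def grad_reg_def hess_reg_def d1_def d2_def e' w_def matrix_vector_right_distrib
          matrix_vector_mult_add_rdistrib algebra_simps scaleR_matrix_vector_assoc[symmetric])
    have "\<kappa> * (norm e')\<^sup>2 \<le> e' \<bullet> (?H *v e')" by (rule coercive_V) fact
    also have "\<dots> = e' \<bullet> R - e' \<bullet> (d1 + d2 + \<sigma> l *\<^sub>R ((1 / 2) *\<^sub>R p - w))"
      using grad_xs_V[OF \<open>e' \<in> V\<close>] unfolding R by (simp add: inner_add_right inner_commute)
    also have "e' \<bullet> R = e' \<bullet> ZZt (Z l) R" using ZZ(1)[OF \<open>e' \<in> V\<close>] by simp
    also have "e' \<bullet> ZZt (Z l) R - e' \<bullet> (d1 + d2 + \<sigma> l *\<^sub>R ((1 / 2) *\<^sub>R p - w))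
        = e' \<bullet> (ZZt (Z l) R - (d1 + d2 + \<sigma> l *\<^sub>R ((1 / 2) *\<^sub>R p - w)))" by (simp add: inner_diff_right)
    also have "\<dots> \<le> norm e' * norm (ZZt (Z l) R - (d1 + d2 + \<sigma> l *\<^sub>R ((1 / 2) *\<^sub>R p - w)))"
      by (rule norm_cauchy_schwarz)
    finally have "norm e' * (\<kappa> * norm e') \<le> norm e' * norm (ZZt (Z l) R - (d1 + d2 + \<sigma> l *\<^sub>R ((1 / 2) *\<^sub>R p - w)))"
      by (simp add: power2_eq_square mult_ac)
    then have "\<kappa> * norm e' \<le> norm (ZZt (Z l) R - (d1 + d2 + \<sigma> l *\<^sub>R ((1 / 2) *\<^sub>R p - w)))"
      by (cases "e' = 0") auto
    also have "\<dots> \<le> norm (ZZt (Z l) R) + (norm d1 + norm d2 + norm (\<sigma> l *\<^sub>R ((1 / 2) *\<^sub>R p - w)))"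
      by (intro order_trans[OF norm_triangle_ineq4] add_mono order_refl order_trans[OF norm_triangle_ineq])
    also have "norm (\<sigma> l *\<^sub>R ((1 / 2) *\<^sub>R p - w)) \<le> \<sigma>hi * (norm p / 2 + Cz * norm e)"
    proof -
      have "norm ((1 / 2) *\<^sub>R p - w) \<le> norm p / 2 + Cz * norm e"
        using norm_triangle_ineq4[of "(1 / 2) *\<^sub>R p" w] Cz[of l] by (simp add: w_def e_def)
      then show ?thesis
        unfolding norm_scaleR using \<sigma>_bounds[of l] \<sigma>lo_pos by (intro mult_mono) auto
    qed
    finally have "\<kappa> * norm e' \<le> \<xi> l * (Bhat * norm e) + (\<epsilon> * norm e + \<epsilon> * norm p + \<sigma>hi * (norm p / 2 + Cz * norm e))"
      using res' d1 d2 by linarith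
    also have "\<dots> = (\<xi> l * Bhat + \<epsilon> + \<sigma>hi * Cz) * norm e + (\<epsilon> + \<sigma>hi / 2) * norm p" by (simp add: algebra_simps)
    also have "\<dots> \<le> (\<xi> l * Bhat + \<epsilon> + \<sigma>hi * Cz) * norm e + (\<epsilon> + \<sigma>hi / 2) * (norm e' + norm e)"
    proof (intro add_left_mono mult_left_mono)
      show "norm p \<le> norm e' + norm e" using norm_triangle_ineq4[of e' e] by (simp add: e')
      show "0 \<le> \<epsilon> + \<sigma>hi / 2" using \<open>0 < \<epsilon>\<close> \<sigma>_bounds[of l] \<sigma>lo_pos by simp
    qed
    finally have "(\<kappa> - \<epsilon> - \<sigma>hi / 2) * norm e' \<le> (\<xi> l * Bhat + 2 * \<epsilon> + \<sigma>hi * (Cz + 1 / 2)) * norm e"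
      by (simp add: algebra_simps add_divide_distrib)
    then show ?case using elim by (simp add: e'_def e_def)
  qed
qed

end

section \<open>Uniform thresholds for the convergence rate\<close>

context trap
begin

lemma local_rate:
  assumes "x0 \<in> Omega P" "0 < \<kappa>" "0 < \<gamma>s" "0 < \<rho>" "\<rho> < 1"
  obtains \<sigma>0 \<xi>0 where "0 < \<sigma>0" "0 < \<xi>0"
    "\<And>\<sigma>lo \<sigma>hi x xs \<xi>. 0 < \<sigma>lo \<Longrightarrow> \<sigma>hi \<le> \<sigma>0 \<Longrightarrow> local_convergence_setting P T \<sigma>lo \<sigma>hi L x0 \<kappa> \<gamma>s x xs \<xi> \<Longrightarrow>
       \<forall>\<^sub>F l in sequentially. \<xi> l \<le> \<xi>0 \<Longrightarrow> Q_linear x xs \<rho>"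
proof -
  obtain Cz where Cz: "0 \<le> Cz" "\<And>x a z \<Delta>. x \<in> Omega P \<Longrightarrow> critical L (Omega P) a \<Longrightarrow>
    cauchy_point P T L x \<Delta> z \<Longrightarrow> norm (z - x) \<le> Cz * norm (x - a)"
    using cauchy_step_bound by metis
  \<comment> \<open>Each of the three summands of the right coefficient in \<open>rate\<close> is
    kept within \<open>\<rho> * \<kappa> / 8\<close>, so their sum stays below
    \<open>\<rho> * \<kappa> / 2\<close>, while the left coefficient stays above
    \<open>\<kappa> / 2\<close>.\<close>
  define \<sigma>0 where "\<sigma>0 = \<rho> * \<kappa> / (8 * (Cz + 1 / 2))"
  define \<xi>0 where "\<xi>0 = \<rho> * \<kappa> / (8 * Bhat)"
  define \<epsilon> where "\<epsilon> = \<rho> * \<kappa> / 16"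
  have pos: "0 < \<rho> * \<kappa>" "\<rho> * \<kappa> \<le> \<kappa>" using assms by auto
  show thesis
  proof
    show \<sigma>0: "0 < \<sigma>0" using pos Cz(1) by (simp add: \<sigma>0_def)
    show "0 < \<xi>0" using pos Bhat_pos by (simp add: \<xi>0_def)
    have \<epsilon>: "0 < \<epsilon>" using pos by (simp add: \<epsilon>_def)
    fix \<sigma>lo \<sigma>hi x xs \<xi>
    assume \<sigma>: "0 < \<sigma>lo" "\<sigma>hi \<le> \<sigma>0" and setting: "local_convergence_setting P T \<sigma>lo \<sigma>hi L x0 \<kappa> \<gamma>s x xs \<xi>"
      and \<xi>_small: "\<forall>\<^sub>F l in sequentially. \<xi> l \<le> \<xi>0"
    obtain \<Delta> z y \<sigma> Z where is_run: "trap_run P T \<sigma>lo \<sigma>hi L x0 x \<Delta> z y \<sigma>"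
      "\<And>l. orthonormal_basis_of (Z l) (active_subspace P (z l))"
      "inexact_refinement P L \<gamma>s \<xi> x \<Delta> z y \<sigma> Z"
      using setting unfolding local_convergence_setting_def by blast
    interpret trap_iterates P T L Bhat xs \<kappa> \<sigma>lo \<sigma>hi x0 x \<Delta> z y \<sigma>
      by unfold_locales (use setting assms \<sigma> is_run in \<open>auto simp: local_convergence_setting_def\<close>)
    have \<xi>_pos: "0 < \<xi> l" for l using setting by (simp add: local_convergence_setting_def)
    have small: "\<sigma>0 * (Cz + 1 / 2) = \<rho> * \<kappa> / 8" "\<sigma>0 / 2 \<le> \<rho> * \<kappa> / 8" "\<xi>0 * Bhat = \<rho> * \<kappa> / 8"
    proof -
      show *: "\<sigma>0 * (Cz + 1 / 2) = \<rho> * \<kappa> / 8" using Cz(1) by (simp add: \<sigma>0_def field_simps)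
      have "\<sigma>0 * (1 / 2) \<le> \<sigma>0 * (Cz + 1 / 2)" using \<sigma>0 Cz(1) by (intro mult_left_mono) auto
      with * show "\<sigma>0 / 2 \<le> \<rho> * \<kappa> / 8" by simp
      show "\<xi>0 * Bhat = \<rho> * \<kappa> / 8" using Bhat_pos by (simp add: \<xi>0_def)
    qed
    have "\<forall>\<^sub>F l in sequentially. (\<kappa> - \<epsilon> - \<sigma>hi / 2) * norm (x (Suc l) - xs)
        \<le> (\<xi> l * Bhat + 2 * \<epsilon> + \<sigma>hi * (Cz + 1 / 2)) * norm (x l - xs)"
      by (rule rate[OF Cz(2)[OF x_Omega xs_critical cauchy] is_run(2,3) \<open>0 < \<gamma>s\<close> \<epsilon> \<xi>_pos])
    then have "\<forall>\<^sub>F l in sequentially. norm (x (Suc l) - xs) / norm (x l - xs) \<le> \<rho>"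
      using \<xi>_small
    proof eventually_elim
      case (elim l)
      have "\<kappa> / 2 * norm (x (Suc l) - xs) \<le> (\<kappa> - \<epsilon> - \<sigma>hi / 2) * norm (x (Suc l) - xs)"
      proof (rule mult_right_mono)
        show "\<kappa> / 2 \<le> \<kappa> - \<epsilon> - \<sigma>hi / 2" using \<sigma>(2) small pos unfolding \<epsilon>_def by linarith
      qed simp
      also note elim(1)
      also have "(\<xi> l * Bhat + 2 * \<epsilon> + \<sigma>hi * (Cz + 1 / 2)) * norm (x l - xs) \<le> \<rho> * \<kappa> / 2 * norm (x l - xs)"
      proof (rule mult_right_mono)
        have "\<xi> l * Bhat \<le> \<xi>0 * Bhat" using elim(2) Bhat_pos by simp
        moreover have "\<sigma>hi * (Cz + 1 / 2) \<le> \<sigma>0 * (Cz + 1 / 2)" using \<sigma>(2) Cz(1) by (intro mult_right_mono) auto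
        ultimately show "\<xi> l * Bhat + 2 * \<epsilon> + \<sigma>hi * (Cz + 1 / 2) \<le> \<rho> * \<kappa> / 2"
          using small pos unfolding \<epsilon>_def by linarith
      qed simp
      finally have "\<kappa> / 2 * norm (x (Suc l) - xs) \<le> \<kappa> / 2 * (\<rho> * norm (x l - xs))" by (simp add: mult_ac)
      then have "norm (x (Suc l) - xs) \<le> \<rho> * norm (x l - xs)" using \<open>0 < \<kappa>\<close> by simp
      \<comment> \<open>Iterates are never critical whereas \<open>xs\<close> is, so the quotient
        has a positive denominator.\<close>
      moreover have "x l \<noteq> xs" using not_critical[of l] xs_critical by auto
      ultimately show ?case by (simp add: pos_divide_le_eq)
    qed
    then show "Q_linear x xs \<rho>" using x_converges assms by (simp add: Q_linear_def)
  qed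
qed

end

theorem theorem4p4:
  fixes P :: "('n::finite) block_polyhedra"
    and T :: trap_params
    and L :: "real^'n \<Rightarrow> real"
    and U :: "(real^'n) set"
    and x0 :: "real^'n"
    and Bhat \<kappa> \<gamma>s :: real
  assumes "is_block_polyhedra P"
    and "is_trap_params T"
    and "x0 \<in> Omega P"
    and "bdd_below (L ` {x \<in> Omega P. L x \<le> L x0})"
    and "open U" and "Omega P \<subseteq> U"
    and "\<And>x. x \<in> U \<Longrightarrow> L differentiable (at x)"
    and "continuous_on U (grad L)"
    and "uniformly_continuous_on (Omega P) (grad L)"
    and "\<And>x. x \<in> Omega P \<Longrightarrow> grad L differentiable (at x)"
    and "0 < Bhat"
    and "\<And>x. x \<in> Omega P \<Longrightarrow> onorm (\<lambda>v. hess L x *v v) \<le> Bhat"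
    and "0 < \<kappa>"
    and "0 < \<gamma>s" and "\<gamma>s < \<gamma>2 T"
  shows "(\<exists>\<sigma>0>0. \<forall>\<sigma>lo \<sigma>hi. 0 < \<sigma>lo \<and> \<sigma>lo < \<sigma>hi \<and> \<sigma>hi \<le> \<sigma>0 \<longrightarrow>
           (\<exists>\<xi>0>0. \<xi>0 < 1 \<and>
             (\<forall>x xs \<xi>. local_convergence_setting P T \<sigma>lo \<sigma>hi L x0 \<kappa> \<gamma>s x xs \<xi> \<and>
                limsup (\<lambda>l. ereal (\<xi> l)) \<le> ereal \<xi>0 \<longrightarrow>
                (\<exists>\<rho>. Q_linear x xs \<rho>)))) \<and>
         (\<forall>\<epsilon>. 0 < \<epsilon> \<and> \<epsilon> < 1 \<longrightarrow>
           (\<exists>\<sigma>0>0. \<forall>\<sigma>lo \<sigma>hi. 0 < \<sigma>lo \<and> \<sigma>lo < \<sigma>hi \<and> \<sigma>hi \<le> \<sigma>0 \<longrightarrow>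
             (\<forall>x xs \<xi>. local_convergence_setting P T \<sigma>lo \<sigma>hi L x0 \<kappa> \<gamma>s x xs \<xi> \<and>
                limsup (\<lambda>l. ereal (\<xi> l)) = 0 \<longrightarrow>
                Q_linear x xs \<epsilon>)))"
proof -
  interpret trap P T L Bhat
    by unfold_locales (use assms in auto)
  have limsup_lt: "\<forall>\<^sub>F l in sequentially. \<xi> l \<le> b" if "limsup (\<lambda>l. ereal (\<xi> l)) < ereal b" for \<xi> b
    using Limsup_lessD[OF that] by eventually_elim simp
  show ?thesis
  proof (intro conjI allI impI)
    obtain \<sigma>0 \<xi>1 where *: "0 < \<sigma>0" "0 < \<xi>1"
      "\<And>\<sigma>lo \<sigma>hi x xs \<xi>. 0 < \<sigma>lo \<Longrightarrow> \<sigma>hi \<le> \<sigma>0 \<Longrightarrow> local_convergence_setting P T \<sigma>lo \<sigma>hi L x0 \<kappa> \<gamma>s x xs \<xi> \<Longrightarrow>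
         \<forall>\<^sub>F l in sequentially. \<xi> l \<le> \<xi>1 \<Longrightarrow> Q_linear x xs (1 / 2)"
      by (rule local_rate[OF \<open>x0 \<in> Omega P\<close> \<open>0 < \<kappa>\<close> \<open>0 < \<gamma>s\<close>, of "1 / 2"]) (auto intro: that)
    \<comment> \<open>Strictly below \<open>\<xi>1\<close>, since a bound on the limsup yields an
      eventual bound only with some room; the cap 1/2 ensures \<open>\<xi>0 < 1\<close>.\<close>
    define \<xi>0 where "\<xi>0 = min (1 / 2) (\<xi>1 / 2)"
    have \<xi>0: "0 < \<xi>0" "\<xi>0 < 1" "\<xi>0 < \<xi>1" using *(2) by (auto simp: \<xi>0_def min_def)
    show "\<exists>\<sigma>0>0. \<forall>\<sigma>lo \<sigma>hi. 0 < \<sigma>lo \<and> \<sigma>lo < \<sigma>hi \<and> \<sigma>hi \<le> \<sigma>0 \<longrightarrow>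
        (\<exists>\<xi>0>0. \<xi>0 < 1 \<and> (\<forall>x xs \<xi>. local_convergence_setting P T \<sigma>lo \<sigma>hi L x0 \<kappa> \<gamma>s x xs \<xi> \<and>
           limsup (\<lambda>l. ereal (\<xi> l)) \<le> ereal \<xi>0 \<longrightarrow> (\<exists>\<rho>. Q_linear x xs \<rho>)))"
    proof (rule exI[of _ \<sigma>0], intro conjI *(1) allI impI)
      fix \<sigma>lo \<sigma>hi assume \<sigma>: "0 < \<sigma>lo \<and> \<sigma>lo < \<sigma>hi \<and> \<sigma>hi \<le> \<sigma>0"
      have "Q_linear x xs (1 / 2)"
        if "local_convergence_setting P T \<sigma>lo \<sigma>hi L x0 \<kappa> \<gamma>s x xs \<xi>" "limsup (\<lambda>l. ereal (\<xi> l)) \<le> ereal \<xi>0" for x xs \<xi>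
      proof -
        have "limsup (\<lambda>l. ereal (\<xi> l)) < ereal \<xi>1"
          using that(2) \<xi>0(3) by (meson less_ereal.simps(1) order_le_less_trans)
        then show ?thesis using *(3)[of \<sigma>lo \<sigma>hi x xs \<xi>] \<sigma> that(1) limsup_lt by blast
      qed
      then show "\<exists>\<xi>0>0. \<xi>0 < 1 \<and> (\<forall>x xs \<xi>. local_convergence_setting P T \<sigma>lo \<sigma>hi L x0 \<kappa> \<gamma>s x xs \<xi> \<and>
           limsup (\<lambda>l. ereal (\<xi> l)) \<le> ereal \<xi>0 \<longrightarrow> (\<exists>\<rho>. Q_linear x xs \<rho>))"
        using \<xi>0(1,2) by (intro exI[of _ \<xi>0]) blast
    qed
  next
    fix \<epsilon> :: real assume \<epsilon>: "0 < \<epsilon> \<and> \<epsilon> < 1"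
    obtain \<sigma>0 \<xi>1 where *: "0 < \<sigma>0" "0 < \<xi>1"
      "\<And>\<sigma>lo \<sigma>hi x xs \<xi>. 0 < \<sigma>lo \<Longrightarrow> \<sigma>hi \<le> \<sigma>0 \<Longrightarrow> local_convergence_setting P T \<sigma>lo \<sigma>hi L x0 \<kappa> \<gamma>s x xs \<xi> \<Longrightarrow>
         \<forall>\<^sub>F l in sequentially. \<xi> l \<le> \<xi>1 \<Longrightarrow> Q_linear x xs \<epsilon>"
      by (rule local_rate[OF \<open>x0 \<in> Omega P\<close> \<open>0 < \<kappa>\<close> \<open>0 < \<gamma>s\<close>, of \<epsilon>]) (use \<epsilon> in \<open>auto intro: that\<close>)
    show "\<exists>\<sigma>0>0. \<forall>\<sigma>lo \<sigma>hi. 0 < \<sigma>lo \<and> \<sigma>lo < \<sigma>hi \<and> \<sigma>hi \<le> \<sigma>0 \<longrightarrow>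
        (\<forall>x xs \<xi>. local_convergence_setting P T \<sigma>lo \<sigma>hi L x0 \<kappa> \<gamma>s x xs \<xi> \<and>
           limsup (\<lambda>l. ereal (\<xi> l)) = 0 \<longrightarrow> Q_linear x xs \<epsilon>)"
    proof (rule exI[of _ \<sigma>0], intro conjI *(1) allI impI)
      fix \<sigma>lo \<sigma>hi x xs \<xi>
      assume "0 < \<sigma>lo \<and> \<sigma>lo < \<sigma>hi \<and> \<sigma>hi \<le> \<sigma>0" and
        "local_convergence_setting P T \<sigma>lo \<sigma>hi L x0 \<kappa> \<gamma>s x xs \<xi> \<and> limsup (\<lambda>l. ereal (\<xi> l)) = 0"
      then show "Q_linear x xs \<epsilon>"
        using *(3)[of \<sigma>lo \<sigma>hi x xs \<xi>] *(2) limsup_lt[of \<xi> \<xi>1] by simp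
    qed
  qed
qed

end
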